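(* Let $\alpha\in(0,1)$, $C\ge2$, $\Phi(c_{\alpha/2})=1-\alpha/2$. Let $S$ be an egalitarian subsampling procedure with fraction function $r(N)\in(0,1)$ on a dataset $D$ with $|D|=N$, producing subsets $D_1,\dots,D_C$, and let $r(N)<\rho_0\le1$. Suppose that under the global null and conditionally on the draw of $S$, the test statistics $(T_1,\dots,T_C)$ are jointly normal with $T_i\sim\mathcal N(0,1)$ and pairwise correlations $\rho_{ij}$ satisfying $|\rho_{ij}|\le|D_i\cap D_j|/(Nr(N))$. Let $E=\sum_{i=1}^C\mathbf 1_{R_i}$ with $R_i=\{|T_i|>c_{\alpha/2}\}$. Then $$\mathbb E_S[\mathbb V(E)]\le C\alpha(1-\alpha)+C(C-1)\left[\alpha(1-\alpha)\,p_{mixed}(N,r(N),\rho_0)+R(\rho_0,c_{\alpha/2})\right]$$ and $$\mathrm{EVR}(S)\le1+\frac{C-1}{\alpha(1-\alpha)}\left[\alpha(1-\alpha)\,p_{mixed}(N,r(N),\rho_0)+R(\rho_0,c_{\alpha/2})\right].$$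
   Context: A procedure $S$ producing random subsets $D_1,\dots,D_C$ of $D$ is egalitarian with fraction function $r$ if (i) $|D_i|/N=r(N)$ for all $i$; (ii) each $D_i$ is uniform over the subsets of $D$ of size $Nr(N)$; (iii) $D_1,\dots,D_C$ are independent. With $\delta=\rho_0/r(N)-1$, define $p_{mixed}(N,r(N),\rho_0)=\min\left\{\left(\frac{e^{\delta}}{(1+\delta)^{1+\delta}}\right)^{Nr(N)^2},\,e^{-2\delta^2Nr(N)^3}\right\}$. Define $R(\rho,c)=2\left[\Phi_\rho(c,c)+\Phi_{-\rho}(c,c)-2\Phi(c)^2\right]$, where $\Phi$ is the standard normal CDF and $\Phi_\rho$ the CDF of the bivariate normal law with zero means, unit variances and correlation $\rho$ (degenerate if $|\rho|=1$). $\mathbb V(E)$ is the conditional variance of $E$ given the draw of $S$, $\mathbb E_S$ is expectation over the draw of $S$, and $\mathrm{EVR}(S)=\mathbb E_S[\mathbb V(E)]/(C\alpha(1-\alpha))$. *)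

theory Defs
  imports "HOL-Probability.Probability"
begin

abbreviation std_normal_cdf :: "real \<Rightarrow> real" where
  "std_normal_cdf \<equiv> cdf std_normal_distribution"

text \<open>
  The bivariate normal law with zero means, unit variances and correlation \<open>\<rho> \<in> [-1, 1]\<close>:
  the law of \<open>(X, \<rho> X + sqrt (1 - \<rho>\<^sup>2) Y)\<close> for independent standard normal \<open>X\<close>, \<open>Y\<close>.
  For \<open>\<bar>\<rho>\<bar> = 1\<close> this is the degenerate law, carried by a line.
\<close>

definition bivariate_normal :: "real \<Rightarrow> (real \<times> real) measure" where
  "bivariate_normal \<rho> =
     distr (std_normal_distribution \<Otimes>\<^sub>M std_normal_distribution) (borel \<Otimes>\<^sub>M borel)
       (\<lambda>(x, y). (x, \<rho> * x + sqrt (1 - \<rho>\<^sup>2) * y))"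

definition bivariate_normal_cdf :: "real \<Rightarrow> real \<Rightarrow> real \<Rightarrow> real" where
  "bivariate_normal_cdf \<rho> a b = measure (bivariate_normal \<rho>) ({..a} \<times> {..b})"

definition R_excess :: "real \<Rightarrow> real \<Rightarrow> real" where
  "R_excess \<rho> c =
     2 * (bivariate_normal_cdf \<rho> c c + bivariate_normal_cdf (- \<rho>) c c - 2 * (std_normal_cdf c)\<^sup>2)"

definition p_mixed :: "nat \<Rightarrow> real \<Rightarrow> real \<Rightarrow> real" where
  "p_mixed N r \<rho>\<^sub>0 =
     (let \<delta> = \<rho>\<^sub>0 / r - 1 in
      min ((exp \<delta> / (1 + \<delta>) powr (1 + \<delta>)) powr (real N * r\<^sup>2))
          (exp (- 2 * \<delta>\<^sup>2 * real N * r ^ 3)))"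

definition correlation :: "'a measure \<Rightarrow> ('a \<Rightarrow> real) \<Rightarrow> ('a \<Rightarrow> real) \<Rightarrow> real" where
  "correlation M X Y =
     prob_space.expectation M (\<lambda>\<omega>. (X \<omega> - prob_space.expectation M X) * (Y \<omega> - prob_space.expectation M Y))
       / sqrt (prob_space.variance M X * prob_space.variance M Y)"

text \<open>
  Joint normality: every linear combination is normal, where constants count as normal laws of
  variance zero. Degenerate covariance matrices are therefore allowed.
\<close>

definition jointly_normal :: "'a measure \<Rightarrow> 'i set \<Rightarrow> ('i \<Rightarrow> 'a \<Rightarrow> real) \<Rightarrow> bool" where
  "jointly_normal M I X \<longleftrightarrow>
     (\<forall>i\<in>I. X i \<in> borel_measurable M) \<and>
     (\<forall>a. \<exists>\<mu> \<sigma>.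
        (0 < \<sigma> \<and> distributed M lborel (\<lambda>\<omega>. \<Sum>i\<in>I. a i * X i \<omega>) (normal_density \<mu> \<sigma>)) \<or>
        (AE \<omega> in M. (\<Sum>i\<in>I. a i * X i \<omega>) = \<mu>))"

definition egalitarian ::
    "'a measure \<Rightarrow> 'd set \<Rightarrow> nat \<Rightarrow> (nat \<Rightarrow> 'a \<Rightarrow> 'd set) \<Rightarrow> (nat \<Rightarrow> real) \<Rightarrow> bool" where
  "egalitarian M D C Ds r \<longleftrightarrow>
     (\<forall>i\<in>{1..C}. \<forall>\<omega>\<in>space M. Ds i \<omega> \<subseteq> D \<and> real (card (Ds i \<omega>)) / real (card D) = r (card D)) \<and>
     (\<forall>i\<in>{1..C}. distr M (count_space (Pow D)) (Ds i) =
        uniform_measure (count_space (Pow D)) {A. A \<subseteq> D \<and> real (card A) = real (card D) * r (card D)}) \<and>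
     prob_space.indep_vars M (\<lambda>_. count_space (Pow D)) Ds {1..C}"

text \<open>
  A draw of the procedure is the tuple of the subsets produced. There are finitely many possible
  draws, so conditioning on the draw is elementary: \<open>given_draw M C Ds \<omega>\<close> is the probability \<open>M\<close>
  conditioned on the event that the draw is the one realised at \<open>\<omega>\<close>. This is meaningful
  when that event has positive probability, which is the case for almost every \<open>\<omega>\<close>.
\<close>

definition draw :: "nat \<Rightarrow> (nat \<Rightarrow> 'a \<Rightarrow> 'd set) \<Rightarrow> 'a \<Rightarrow> (nat \<Rightarrow> 'd set)" where
  "draw C Ds \<omega> = (\<lambda>i\<in>{1..C}. Ds i \<omega>)"

definition given_draw :: "'a measure \<Rightarrow> nat \<Rightarrow> (nat \<Rightarrow> 'a \<Rightarrow> 'd set) \<Rightarrow> 'a \<Rightarrow> 'a measure" where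
  "given_draw M C Ds \<omega> = uniform_measure M {\<omega>'\<in>space M. draw C Ds \<omega>' = draw C Ds \<omega>}"

definition cond_variance ::
    "'a measure \<Rightarrow> nat \<Rightarrow> (nat \<Rightarrow> 'a \<Rightarrow> 'd set) \<Rightarrow> ('a \<Rightarrow> real) \<Rightarrow> 'a \<Rightarrow> real" where
  "cond_variance M C Ds X \<omega> = prob_space.variance (given_draw M C Ds \<omega>) X"

definition expected_cond_variance ::
    "'a measure \<Rightarrow> nat \<Rightarrow> (nat \<Rightarrow> 'a \<Rightarrow> 'd set) \<Rightarrow> ('a \<Rightarrow> real) \<Rightarrow> real" where
  "expected_cond_variance M C Ds X = prob_space.expectation M (cond_variance M C Ds X)"

definition num_rejections :: "nat \<Rightarrow> (nat \<Rightarrow> 'a \<Rightarrow> real) \<Rightarrow> real \<Rightarrow> 'a \<Rightarrow> real" where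
  "num_rejections C T c \<omega> = (\<Sum>i=1..C. indicator {\<omega>. \<bar>T i \<omega>\<bar> > c} \<omega>)"

definition EVR ::
    "'a measure \<Rightarrow> nat \<Rightarrow> (nat \<Rightarrow> 'a \<Rightarrow> 'd set) \<Rightarrow> ('a \<Rightarrow> real) \<Rightarrow> real \<Rightarrow> real" where
  "EVR M C Ds E \<alpha> = expected_cond_variance M C Ds E / (real C * \<alpha> * (1 - \<alpha>))"

end

theory Submission
  imports Defs
begin

text \<open>
  Given the draw, the variance of the number of rejections is the sum of the covariances of the
  rejection indicators. A covariance is at most \<open>\<alpha> (1 - \<alpha>)\<close>, and for a pair with correlation
  \<open>\<rho>\<close> it equals the excess \<open>R(\<rho>, c)\<close>. Since the rejection regions are symmetric, \<open>R\<close> depends only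
  on \<open>\<bar>\<rho>\<bar>\<close>; it is monotone there because, for a correlation \<open>\<rho> \<ge> 0\<close>,
  \<open>P(X \<in> I, Y \<in> I)\<close> is the squared \<open>L\<^sup>2\<close> norm of the Ornstein-Uhlenbeck operator with parameter
  \<open>sqrt \<rho>\<close> applied to the indicator of \<open>I\<close>, and these operators form a semigroup of contractions.
  Hence only draws in which two subsets overlap in more than a fraction \<open>\<rho>\<^sub>0\<close> of their size can
  exceed \<open>R(\<rho>\<^sub>0, c)\<close>. The overlap is hypergeometric, its moment generating function is at most that
  of the corresponding binomial law, and the Chernoff and Hoeffding bounds give \<open>p_mixed\<close>.
\<close>

section \<open>Laws of pairs are determined by characteristic functions\<close>

lemma weighted_law:
  fixes X g :: "'a \<Rightarrow> real"
  assumes [measurable]: "X \<in> borel_measurable M"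
    and g: "integrable M g" "\<And>x. 0 \<le> g x" and m: "(LINT x|M. g x) = m" "0 < m"
  defines "N \<equiv> distr (density M (\<lambda>x. g x / m)) borel X"
  shows "real_distribution N"
    and "char N s = (CLINT x|M. g x *\<^sub>R iexp (s * X x)) / m"
    and "A \<in> sets borel \<Longrightarrow> measure N A = (LINT x|M. g x * indicator A (X x)) / m"
proof -
  have [measurable]: "g \<in> borel_measurable M" using g by auto
  have "emeasure (density M (\<lambda>x. g x / m)) (space M) = (\<integral>\<^sup>+x. ennreal (g x / m) \<partial>M)"
    by (subst emeasure_density) (auto intro!: nn_integral_cong)
  also have "\<dots> = ennreal (LINT x|M. g x / m)"
    using g m by (intro nn_integral_eq_integral) auto
  also have "\<dots> = 1" using m by simp
  finally have "emeasure (density M (\<lambda>x. g x / m)) (space M) = 1" .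
  then interpret D: prob_space "density M (\<lambda>x. g x / m)" by (intro prob_spaceI) simp
  show "real_distribution N"
    unfolding N_def by (rule D.real_distribution_distr) simp
  have "char N s = (CLINT x|density M (\<lambda>x. g x / m). iexp (s * X x))"
    unfolding char_def N_def by (subst integral_distr) auto
  also have "\<dots> = (CLINT x|M. (g x / m) *\<^sub>R iexp (s * X x))"
    using g m by (subst integral_density) auto
  also have "\<dots> = (CLINT x|M. (g x *\<^sub>R iexp (s * X x)) / m)"
    by (intro Bochner_Integration.integral_cong) (auto simp: scaleR_conv_of_real)
  finally show "char N s = (CLINT x|M. g x *\<^sub>R iexp (s * X x)) / m" by simp
  assume A[measurable]: "A \<in> sets borel"
  have "measure N A = (LINT x|N. indicator A x)"
    by (simp add: N_def)
  also have "\<dots> = (LINT x|density M (\<lambda>x. g x / m). indicator A (X x))"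
    unfolding N_def by (subst integral_distr) auto
  also have "\<dots> = (LINT x|M. (g x / m) *\<^sub>R indicator A (X x))"
    using g m by (subst integral_density) auto
  also have "\<dots> = (LINT x|M. (g x * indicator A (X x)) / m)"
    by (intro Bochner_Integration.integral_cong) auto
  finally show "measure N A = (LINT x|M. g x * indicator A (X x)) / m" by simp
qed

text \<open>One-dimensional uniqueness for finite measures in place of probability laws. If the
  common mass is zero, both weights vanish almost everywhere; otherwise both sides are normalised
  and Levy's theorem applies.\<close>

lemma weighted_char_uniqueness:
  fixes X1 g1 :: "'a \<Rightarrow> real" and X2 g2 :: "'b \<Rightarrow> real"
  assumes X1[measurable]: "X1 \<in> borel_measurable M1" and X2[measurable]: "X2 \<in> borel_measurable M2"
    and g1: "integrable M1 g1" "\<And>x. 0 \<le> g1 x" and g2: "integrable M2 g2" "\<And>x. 0 \<le> g2 x"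
    and char: "\<And>s. (CLINT x|M1. g1 x *\<^sub>R iexp (s * X1 x)) = (CLINT x|M2. g2 x *\<^sub>R iexp (s * X2 x))"
    and A[measurable]: "A \<in> sets borel"
  shows "(LINT x|M1. g1 x * indicator A (X1 x)) = (LINT x|M2. g2 x * indicator A (X2 x))"
proof -
  define m where "m = (LINT x|M1. g1 x)"
  \<comment> \<open>At \<open>s = 0\<close> the transform is the total mass, so one constant
    \<open>m\<close> normalises both weights.\<close>
  have m2: "(LINT x|M2. g2 x) = m"
    using char[of 0] by (simp add: m_def scaleR_conv_of_real)
  have m1: "(LINT x|M1. g1 x) = m" by (simp add: m_def)
  have "m \<ge> 0" unfolding m_def by (intro integral_nonneg_AE) (simp add: g1)
  show ?thesis
  proof (cases "m = 0")
    case True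
    have "AE x in M1. g1 x = 0"
      using g1 True m1 integral_nonneg_eq_0_iff_AE[of M1 g1] by auto
    then have "AE x in M1. g1 x * indicator A (X1 x) = 0" by auto
    then have 1: "(LINT x|M1. g1 x * indicator A (X1 x)) = 0" by (rule integral_eq_zero_AE)
    have "AE x in M2. g2 x = 0"
      using g2 True m2 integral_nonneg_eq_0_iff_AE[of M2 g2] by auto
    then have "AE x in M2. g2 x * indicator A (X2 x) = 0" by auto
    then have "(LINT x|M2. g2 x * indicator A (X2 x)) = 0" by (rule integral_eq_zero_AE)
    with 1 show ?thesis by simp
  next
    case False
    with \<open>m \<ge> 0\<close> have m: "0 < m" by simp
    let ?N1 = "distr (density M1 (\<lambda>x. g1 x / m)) borel X1"
    let ?N2 = "distr (density M2 (\<lambda>x. g2 x / m)) borel X2"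
    have "?N1 = ?N2"
      by (intro Levy_uniqueness weighted_law(1)[OF X1 g1 m1 m] weighted_law(1)[OF X2 g2 m2 m] ext)
         (simp only: weighted_law(2)[OF X1 g1 m1 m] weighted_law(2)[OF X2 g2 m2 m] char)
    then show ?thesis
      using weighted_law(3)[OF X1 g1 m1 m A] weighted_law(3)[OF X2 g2 m2 m A] m by simp
  qed
qed

text \<open>
  The weights \<open>1\<close>, \<open>1 + cos (t Y)\<close> and \<open>1 + sin (t Y)\<close> are nonnegative, so the one-dimensional
  uniqueness theorem applies to \<open>X\<close> under each of them; the resulting identities say that the
  law of \<open>Y\<close> under the weight \<open>1\<^sub>A(X)\<close> has a determined characteristic function as well.
\<close>

lemma char_pair_uniqueness:
  fixes X1 Y1 :: "'a \<Rightarrow> real" and X2 Y2 :: "'b \<Rightarrow> real"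
  assumes "prob_space M1" "prob_space M2"
    and X1[measurable]: "X1 \<in> borel_measurable M1" and Y1[measurable]: "Y1 \<in> borel_measurable M1"
    and X2[measurable]: "X2 \<in> borel_measurable M2" and Y2[measurable]: "Y2 \<in> borel_measurable M2"
    and char: "\<And>s t. (CLINT x|M1. iexp (s * X1 x + t * Y1 x)) = (CLINT x|M2. iexp (s * X2 x + t * Y2 x))"
  shows "distr M1 (borel \<Otimes>\<^sub>M borel) (\<lambda>x. (X1 x, Y1 x)) = distr M2 (borel \<Otimes>\<^sub>M borel) (\<lambda>x. (X2 x, Y2 x))"
proof -
  interpret P1: prob_space M1 by fact
  interpret P2: prob_space M2 by fact
  have int1: "integrable M1 (\<lambda>x. f x)" if "f \<in> borel_measurable M1" "\<And>x. norm (f x) \<le> 2"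
    for f :: "'a \<Rightarrow> 'c::{banach, second_countable_topology}"
    using that by (intro P1.integrable_const_bound[of _ 2]) auto
  have int2: "integrable M2 (\<lambda>x. f x)" if "f \<in> borel_measurable M2" "\<And>x. norm (f x) \<le> 2"
    for f :: "'b \<Rightarrow> 'c::{banach, second_countable_topology}"
    using that by (intro P2.integrable_const_bound[of _ 2]) auto
  \<comment> \<open>Product-to-sum formulas: a cosine or sine weight in \<open>Y\<close> only
    combines the joint characteristic function at \<open>(s, t)\<close> and \<open>(s, -t)\<close>,
    where the two sides agree.\<close>
  have cosform: "cos (b::real) *\<^sub>R iexp a = (iexp (a + b) + iexp (a - b)) / 2" for a b
    by (auto simp: complex_eq_iff Re_exp Im_exp cos_add sin_add cos_diff sin_diff)
  have sinform: "sin (b::real) *\<^sub>R iexp a = (iexp (a + b) - iexp (a - b)) / (2 * \<i>)" for a b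
    by (auto simp: complex_eq_iff Re_exp Im_exp cos_add sin_add cos_diff sin_diff
        Re_divide Im_divide power2_eq_square)
  have i1: "integrable M1 (\<lambda>x. iexp (f x))" if "f \<in> borel_measurable M1" for f :: "'a \<Rightarrow> real"
    using that by (intro int1) auto
  have i2: "integrable M2 (\<lambda>x. iexp (f x))" if "f \<in> borel_measurable M2" for f :: "'b \<Rightarrow> real"
    using that by (intro int2) auto
  have char': "(CLINT x|M1. iexp (s * X1 x - t * Y1 x)) = (CLINT x|M2. iexp (s * X2 x - t * Y2 x))" for s t
    using char[of s "-t"] by simp
  have char1: "(CLINT x|M1. iexp (s * X1 x)) = (CLINT x|M2. iexp (s * X2 x))" for s
    using char[of s 0] by simp
  have ccos: "(CLINT x|M1. cos (t * Y1 x) *\<^sub>R iexp (s * X1 x)) = (CLINT x|M2. cos (t * Y2 x) *\<^sub>R iexp (s * X2 x))" for s t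
    unfolding cosform using char[of s t] char'[of s t]
    by (simp add: i1 i2 del: of_real_add of_real_diff of_real_mult)
  have csin: "(CLINT x|M1. sin (t * Y1 x) *\<^sub>R iexp (s * X1 x)) = (CLINT x|M2. sin (t * Y2 x) *\<^sub>R iexp (s * X2 x))" for s t
    unfolding sinform using char[of s t] char'[of s t]
    by (simp add: i1 i2 del: of_real_add of_real_diff of_real_mult)
  have bnd: "norm (cos (a::real) *\<^sub>R iexp b) \<le> 2" "norm (sin (a::real) *\<^sub>R iexp b) \<le> 2" for a b
    using abs_cos_le_one[of a] abs_sin_le_one[of a] by (simp_all del: abs_cos_le_one abs_sin_le_one)
  have c1: "\<bar>1 + cos a\<bar> \<le> 2" "0 \<le> 1 + cos a" "\<bar>1 + sin a\<bar> \<le> 2" "0 \<le> 1 + sin a" for a :: real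
    using cos_le_one[of a] cos_ge_minus_one[of a] sin_le_one[of a] sin_ge_minus_one[of a]
    by linarith+
  have c2: "norm (cos a * indicator A b) \<le> 2" "norm (sin a * indicator A b) \<le> 2" for a :: real and A and b :: real
    using abs_cos_le_one[of a] abs_sin_le_one[of a] by (auto split: split_indicator simp del: abs_cos_le_one abs_sin_le_one)
  have A1: "(LINT x|M1. indicator A (X1 x) :: real) = (LINT x|M2. indicator A (X2 x))"
    if [measurable]: "A \<in> sets borel" for A
    using weighted_char_uniqueness[OF X1 X2, of "\<lambda>_. 1" "\<lambda>_. 1" A] char1 by simp
  have Acos: "(LINT x|M1. cos (t * Y1 x) * indicator A (X1 x)) = (LINT x|M2. cos (t * Y2 x) * indicator A (X2 x))"
    if [measurable]: "A \<in> sets borel" for A t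
  proof -
    \<comment> \<open>The cosine alone changes sign and is no admissible weight. Adding 1 repairs
      this, and the identity \<open>A1\<close> for the constant weight is subtracted
      afterwards.\<close>
    have "(LINT x|M1. (1 + cos (t * Y1 x)) * indicator A (X1 x)) = (LINT x|M2. (1 + cos (t * Y2 x)) * indicator A (X2 x))"
    proof (rule weighted_char_uniqueness[OF X1 X2])
      show "(CLINT x|M1. (1 + cos (t * Y1 x)) *\<^sub>R iexp (s * X1 x)) = (CLINT x|M2. (1 + cos (t * Y2 x)) *\<^sub>R iexp (s * X2 x))" for s
        unfolding scaleR_add_left scaleR_one using ccos[of t s] char1[of s]
        by (subst (1 2) Bochner_Integration.integral_add) (auto intro!: int1 int2 bnd i1 i2 simp del: norm_scaleR of_real_mult)
    qed (auto intro!: int1 int2 simp: c1)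
    moreover have "(LINT x|M1. (1 + cos (t * Y1 x)) * indicator A (X1 x))
        = (LINT x|M1. indicator A (X1 x)) + (LINT x|M1. cos (t * Y1 x) * indicator A (X1 x))"
      unfolding distrib_right mult_1_left
      by (intro Bochner_Integration.integral_add int1 c2) (auto split: split_indicator)
    moreover have "(LINT x|M2. (1 + cos (t * Y2 x)) * indicator A (X2 x))
        = (LINT x|M2. indicator A (X2 x)) + (LINT x|M2. cos (t * Y2 x) * indicator A (X2 x))"
      unfolding distrib_right mult_1_left
      by (intro Bochner_Integration.integral_add int2 c2) (auto split: split_indicator)
    ultimately show ?thesis
      using A1[OF that] by simp
  qed
  have Asin: "(LINT x|M1. sin (t * Y1 x) * indicator A (X1 x)) = (LINT x|M2. sin (t * Y2 x) * indicator A (X2 x))"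
    if [measurable]: "A \<in> sets borel" for A t
  proof -
    have "(LINT x|M1. (1 + sin (t * Y1 x)) * indicator A (X1 x)) = (LINT x|M2. (1 + sin (t * Y2 x)) * indicator A (X2 x))"
    proof (rule weighted_char_uniqueness[OF X1 X2])
      show "(CLINT x|M1. (1 + sin (t * Y1 x)) *\<^sub>R iexp (s * X1 x)) = (CLINT x|M2. (1 + sin (t * Y2 x)) *\<^sub>R iexp (s * X2 x))" for s
        unfolding scaleR_add_left scaleR_one using csin[of t s] char1[of s]
        by (subst (1 2) Bochner_Integration.integral_add) (auto intro!: int1 int2 bnd i1 i2 simp del: norm_scaleR of_real_mult)
    qed (auto intro!: int1 int2 simp: c1)
    moreover have "(LINT x|M1. (1 + sin (t * Y1 x)) * indicator A (X1 x))
        = (LINT x|M1. indicator A (X1 x)) + (LINT x|M1. sin (t * Y1 x) * indicator A (X1 x))"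
      unfolding distrib_right mult_1_left
      by (intro Bochner_Integration.integral_add int1 c2) (auto split: split_indicator)
    moreover have "(LINT x|M2. (1 + sin (t * Y2 x)) * indicator A (X2 x))
        = (LINT x|M2. indicator A (X2 x)) + (LINT x|M2. sin (t * Y2 x) * indicator A (X2 x))"
      unfolding distrib_right mult_1_left
      by (intro Bochner_Integration.integral_add int2 c2) (auto split: split_indicator)
    ultimately show ?thesis
      using A1[OF that] by simp
  qed
  have expform: "indicator A b *\<^sub>R iexp a = complex_of_real (cos a * indicator A b) + \<i> * complex_of_real (sin a * indicator A b)"
    for a b :: real and A
    by (auto simp: complex_eq_iff Re_exp Im_exp split: split_indicator)
  have AB: "(LINT x|M1. indicator A (X1 x) * indicator B (Y1 x) :: real) = (LINT x|M2. indicator A (X2 x) * indicator B (Y2 x))"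
    if [measurable]: "A \<in> sets borel" "B \<in> sets borel" for A B
  \<comment> \<open>The roles are exchanged: the indicator of \<open>X\<close> in \<open>A\<close>
    is now the weight and \<open>Y\<close> the variable. Its transform has the real and imaginary
    parts \<open>Acos\<close> and \<open>Asin\<close>.\<close>
  proof (rule weighted_char_uniqueness[OF Y1 Y2])
    show "(CLINT x|M1. indicator A (X1 x) *\<^sub>R iexp (s * Y1 x)) = (CLINT x|M2. indicator A (X2 x) *\<^sub>R iexp (s * Y2 x))" for s
    proof -
      have int: "integrable M1 (\<lambda>x. cos (s * Y1 x) * indicator A (X1 x))" "integrable M1 (\<lambda>x. sin (s * Y1 x) * indicator A (X1 x))"
        "integrable M2 (\<lambda>x. cos (s * Y2 x) * indicator A (X2 x))" "integrable M2 (\<lambda>x. sin (s * Y2 x) * indicator A (X2 x))"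
        by (intro int1 int2 c2; measurable)+
      show ?thesis
        unfolding expform using Acos[of A s] Asin[of A s] int
        by (simp del: of_real_mult)
    qed
  qed (auto intro!: int1 int2 split: split_indicator)
  let ?E = "{A \<times> B | A B. A \<in> sets (borel :: real measure) \<and> B \<in> sets (borel :: real measure)}"
  interpret N1: prob_space "distr M1 (borel \<Otimes>\<^sub>M borel) (\<lambda>x. (X1 x, Y1 x))"
    by (rule P1.prob_space_distr) measurable
  show ?thesis
  proof (rule measure_eqI_generator_eq[where E="?E" and \<Omega>="UNIV" and A="\<lambda>_. UNIV"])
    show "Int_stable ?E" by (rule Int_stable_pair_measure_generator)
    fix R assume "R \<in> ?E"
    then obtain A B where R: "R = A \<times> B" and [measurable]: "A \<in> sets borel" "B \<in> sets borel" by auto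
    have rect1: "(LINT x|M1. indicator A (X1 x) * indicator B (Y1 x)) = measure M1 ((\<lambda>x. (X1 x, Y1 x)) -` R \<inter> space M1)"
    proof -
      have "(LINT x|M1. indicator A (X1 x) * indicator B (Y1 x))
          = (LINT x|M1. indicator ((\<lambda>x. (X1 x, Y1 x)) -` R \<inter> space M1) x :: real)"
        unfolding R by (intro Bochner_Integration.integral_cong) (auto split: split_indicator)
      then show ?thesis by (simp add: Int_assoc)
    qed
    have rect2: "(LINT x|M2. indicator A (X2 x) * indicator B (Y2 x)) = measure M2 ((\<lambda>x. (X2 x, Y2 x)) -` R \<inter> space M2)"
    proof -
      have "(LINT x|M2. indicator A (X2 x) * indicator B (Y2 x))
          = (LINT x|M2. indicator ((\<lambda>x. (X2 x, Y2 x)) -` R \<inter> space M2) x :: real)"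
        unfolding R by (intro Bochner_Integration.integral_cong) (auto split: split_indicator)
      then show ?thesis by (simp add: Int_assoc)
    qed
    show "emeasure (distr M1 (borel \<Otimes>\<^sub>M borel) (\<lambda>x. (X1 x, Y1 x))) R
        = emeasure (distr M2 (borel \<Otimes>\<^sub>M borel) (\<lambda>x. (X2 x, Y2 x))) R"
      using AB[of A B] rect1 rect2 by (simp add: R emeasure_distr P1.emeasure_eq_measure P2.emeasure_eq_measure)
  qed (auto simp: sets_pair_measure space_pair_measure intro!: exI[of _ UNIV])
qed

section \<open>The bivariate normal law\<close>

lemma integral_pair_mult:
  fixes f :: "'a \<Rightarrow> complex" and g :: "'b \<Rightarrow> complex"
  assumes "prob_space M1" "prob_space M2"
    and [measurable]: "f \<in> borel_measurable M1" "g \<in> borel_measurable M2"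
    and bnd: "\<And>x. norm (f x) \<le> 1" "\<And>y. norm (g y) \<le> 1"
  shows "(LINT p|(M1 \<Otimes>\<^sub>M M2). f (fst p) * g (snd p)) = (LINT x|M1. f x) * (LINT y|M2. g y)"
proof -
  interpret P1: prob_space M1 by fact
  interpret P2: prob_space M2 by fact
  interpret P: pair_prob_space M1 M2 ..
  have "norm (f (fst p) * g (snd p)) \<le> 1" for p
    using bnd by (simp add: norm_mult mult_le_one)
  then have "integrable (M1 \<Otimes>\<^sub>M M2) (\<lambda>p. f (fst p) * g (snd p))"
    by (intro P.integrable_const_bound[of _ 1]) auto
  from P.integral_fst'[OF this] show ?thesis by simp
qed

lemma prob_space_std_normal: "prob_space std_normal_distribution"
  by (rule prob_space_normal_density) simp

lemma char_std_normal: "(CLINT x|std_normal_distribution. iexp (t * x)) = complex_of_real (exp (- t\<^sup>2 / 2))"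
  using fun_cong[OF char_std_normal_distribution, of t] by (simp add: char_def)

interpretation std_normal: prob_space std_normal_distribution
  by (rule prob_space_std_normal)

interpretation std_normal_pair: pair_prob_space std_normal_distribution std_normal_distribution ..

lemma char_linear_std_normal_pair:
  "(CLINT p|(std_normal_distribution \<Otimes>\<^sub>M std_normal_distribution). iexp (a * fst p + b * snd p))
     = complex_of_real (exp (- (a\<^sup>2 + b\<^sup>2) / 2))"
proof -
  have "(CLINT p|(std_normal_distribution \<Otimes>\<^sub>M std_normal_distribution). iexp (a * fst p + b * snd p))
     = (CLINT p|(std_normal_distribution \<Otimes>\<^sub>M std_normal_distribution). iexp (a * fst p) * iexp (b * snd p))"
    by (intro Bochner_Integration.integral_cong) (auto simp: exp_add[symmetric] algebra_simps)
  also have "\<dots> = (CLINT x|std_normal_distribution. iexp (a * x)) * (CLINT x|std_normal_distribution. iexp (b * x))"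
    by (rule integral_pair_mult) (auto simp: prob_space_std_normal simp del: of_real_mult)
  also have "\<dots> = complex_of_real (exp (- (a\<^sup>2 + b\<^sup>2) / 2))"
    unfolding char_std_normal of_real_mult[symmetric] exp_add[symmetric] by (simp add: field_simps)
  finally show ?thesis .
qed

lemma space_bivariate_normal [simp]: "space (bivariate_normal \<rho>) = UNIV"
  by (simp add: bivariate_normal_def space_pair_measure)

lemma sets_bivariate_normal [simp, measurable_cong]: "sets (bivariate_normal \<rho>) = sets (borel \<Otimes>\<^sub>M borel)"
  by (simp add: bivariate_normal_def)

interpretation bivariate_normal: prob_space "bivariate_normal \<rho>" for \<rho>
  unfolding bivariate_normal_def by (rule std_normal_pair.prob_space_distr) measurable

text \<open>The bound on \<open>\<rho>\<close> lets \<open>sqrt (1 - \<rho>\<^sup>2)\<close> square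
  back to \<open>1 - \<rho>\<^sup>2\<close>, so the exponent collapses to the quadratic form of the
  covariance matrix, also in the degenerate cases.\<close>

lemma char_bivariate_normal:
  assumes "\<bar>\<rho>\<bar> \<le> 1"
  shows "(CLINT p|(bivariate_normal \<rho>). iexp (s * fst p + t * snd p))
     = complex_of_real (exp (- (s\<^sup>2 + 2 * \<rho> * s * t + t\<^sup>2) / 2))"
proof -
  have "\<rho>\<^sup>2 \<le> 1" using assms by (simp add: abs_square_le_1)
  have "(CLINT p|(bivariate_normal \<rho>). iexp (s * fst p + t * snd p))
     = (CLINT p|(std_normal_distribution \<Otimes>\<^sub>M std_normal_distribution).
          iexp (s * fst p + t * (\<rho> * fst p + sqrt (1 - \<rho>\<^sup>2) * snd p)))"
    unfolding bivariate_normal_def by (subst integral_distr) (auto simp: case_prod_beta)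
  also have "\<dots> = (CLINT p|(std_normal_distribution \<Otimes>\<^sub>M std_normal_distribution).
          iexp ((s + t * \<rho>) * fst p + (t * sqrt (1 - \<rho>\<^sup>2)) * snd p))"
    by (intro Bochner_Integration.integral_cong) (auto simp: algebra_simps)
  also have "\<dots> = complex_of_real (exp (- ((s + t * \<rho>)\<^sup>2 + (t * sqrt (1 - \<rho>\<^sup>2))\<^sup>2) / 2))"
    by (rule char_linear_std_normal_pair)
  also have "(s + t * \<rho>)\<^sup>2 + (t * sqrt (1 - \<rho>\<^sup>2))\<^sup>2 = s\<^sup>2 + 2 * \<rho> * s * t + t\<^sup>2"
    using \<open>\<rho>\<^sup>2 \<le> 1\<close> by (simp add: power_mult_distrib) (simp add: power2_eq_square algebra_simps)
  finally show ?thesis .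
qed

text \<open>The common tool for recognising this law: reflections, the representation through a
  shared Gaussian component, and pairs of test statistics are all identified by computing a
  characteristic function.\<close>

lemma distr_eq_bivariate_normal:
  assumes "prob_space M" "\<bar>\<rho>\<bar> \<le> 1"
    and [measurable]: "X \<in> borel_measurable M" "Y \<in> borel_measurable M"
    and char: "\<And>s t. (CLINT x|M. iexp (s * X x + t * Y x))
       = complex_of_real (exp (- (s\<^sup>2 + 2 * \<rho> * s * t + t\<^sup>2) / 2))"
  shows "distr M (borel \<Otimes>\<^sub>M borel) (\<lambda>x. (X x, Y x)) = bivariate_normal \<rho>"
proof -
  have "distr M (borel \<Otimes>\<^sub>M borel) (\<lambda>x. (X x, Y x))
      = distr (bivariate_normal \<rho>) (borel \<Otimes>\<^sub>M borel) (\<lambda>p. (fst p, snd p))"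
    by (rule char_pair_uniqueness[OF assms(1) bivariate_normal.prob_space_axioms])
       (simp_all only: char char_bivariate_normal[OF assms(2)], measurable)
  also have "\<dots> = bivariate_normal \<rho>" by (simp add: distr_id2)
  finally show ?thesis .
qed

section \<open>Symmetries and marginals of the bivariate normal law\<close>

lemma bivariate_normal_uminus:
  assumes "\<bar>\<rho>\<bar> \<le> 1"
  shows "distr (bivariate_normal \<rho>) (borel \<Otimes>\<^sub>M borel) (\<lambda>p. (- fst p, - snd p)) = bivariate_normal \<rho>"
proof (rule distr_eq_bivariate_normal)
  show "(CLINT p|(bivariate_normal \<rho>). iexp (s * - fst p + t * - snd p))
      = complex_of_real (exp (- (s\<^sup>2 + 2 * \<rho> * s * t + t\<^sup>2) / 2))" for s t
    using char_bivariate_normal[OF assms, of "-s" "-t"] by simp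
qed (use assms in \<open>auto simp: bivariate_normal.prob_space_axioms\<close>)

text \<open>Replacing \<open>t\<close> by \<open>-t\<close> flips only the cross term of the
  exponent. This is how the \<Phi> with negative correlation in \<open>R_excess\<close> is turned
  into a probability under the law with correlation \<open>\<rho>\<close>.\<close>

lemma bivariate_normal_uminus_snd:
  assumes "\<bar>\<rho>\<bar> \<le> 1"
  shows "distr (bivariate_normal \<rho>) (borel \<Otimes>\<^sub>M borel) (\<lambda>p. (fst p, - snd p)) = bivariate_normal (- \<rho>)"
proof (rule distr_eq_bivariate_normal)
  show "(CLINT p|(bivariate_normal \<rho>). iexp (s * fst p + t * - snd p))
      = complex_of_real (exp (- (s\<^sup>2 + 2 * - \<rho> * s * t + t\<^sup>2) / 2))" for s t
    using char_bivariate_normal[OF assms, of "s" "-t"] by simp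
qed (use assms in \<open>auto simp: bivariate_normal.prob_space_axioms\<close>)

lemma distr_eq_std_normal:
  assumes "prob_space M" and [measurable]: "X \<in> borel_measurable M"
    and char: "\<And>t. (CLINT x|M. iexp (t * X x)) = complex_of_real (exp (- t\<^sup>2 / 2))"
  shows "distr M borel X = std_normal_distribution"
proof (rule Levy_uniqueness)
  show "char (distr M borel X) = char std_normal_distribution"
    by (rule ext, unfold char_std_normal_distribution char_def, subst integral_distr)
       (use char in auto)
qed (use assms in \<open>auto intro!: real_dist_normal_dist prob_space.real_distribution_distr\<close>)

lemma distr_fst_bivariate_normal:
  assumes "\<bar>\<rho>\<bar> \<le> 1"
  shows "distr (bivariate_normal \<rho>) borel fst = std_normal_distribution"
  using char_bivariate_normal[OF assms, of _ 0]
  by (intro distr_eq_std_normal) (auto simp: bivariate_normal.prob_space_axioms)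

lemma distr_snd_bivariate_normal:
  assumes "\<bar>\<rho>\<bar> \<le> 1"
  shows "distr (bivariate_normal \<rho>) borel snd = std_normal_distribution"
  using char_bivariate_normal[OF assms, of 0]
  by (intro distr_eq_std_normal) (auto simp: bivariate_normal.prob_space_axioms)

lemma distr_uminus_std_normal: "distr std_normal_distribution borel uminus = std_normal_distribution"
  using char_std_normal[of "- _"]
  by (intro distr_eq_std_normal) (auto simp: prob_space_std_normal)

lemma measure_std_normal_less_uminus: "measure std_normal_distribution {..<- c} = 1 - std_normal_cdf c"
proof -
  have "measure std_normal_distribution {..<- c} = measure (distr std_normal_distribution borel uminus) {..<- c}"
    by (simp only: distr_uminus_std_normal)
  also have "\<dots> = measure std_normal_distribution {c<..}"
    by (subst measure_distr) (auto intro!: arg_cong[where f="measure _"])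
  also have "{c<..} = space std_normal_distribution - {..c}" by auto
  also have "measure std_normal_distribution \<dots> = 1 - std_normal_cdf c"
    by (subst std_normal.prob_compl) (auto simp: cdf_def)
  finally show ?thesis .
qed

lemma measure_std_normal_interval:
  assumes "0 \<le> c"
  shows "measure std_normal_distribution {- c..c} = 2 * std_normal_cdf c - 1"
proof -
  have "{..c} = {..<- c} \<union> {- c..c}" using assms by auto
  then have "std_normal_cdf c = measure std_normal_distribution {..<- c} + measure std_normal_distribution {- c..c}"
    unfolding cdf_def by (subst std_normal.finite_measure_Union[symmetric]) auto
  then show ?thesis by (simp add: measure_std_normal_less_uminus)
qed

text \<open>Used in contrapositive form: a critical value \<open>c\<close> whose distribution
  function exceeds one half is nonnegative.\<close>

lemma std_normal_cdf_le_half: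
  assumes "c < 0"
  shows "std_normal_cdf c \<le> 1 / 2"
proof -
  have "std_normal_cdf c \<le> measure std_normal_distribution {..<- c}"
    unfolding cdf_def using assms by (intro std_normal.finite_measure_mono) auto
  then show ?thesis by (simp add: measure_std_normal_less_uminus)
qed

text \<open>Identifies \<open>R_excess\<close> as the covariance of the indicators of the two
  acceptance events. The line is cut into \<open>L\<close>, \<open>I\<close>, \<open>U\<close>
  (below, inside and above the acceptance interval); both quadrant probabilities are sums of cells
  of the resulting grid, and marginals together with the symmetry about the origin eliminate every
  cell except \<open>I \<times> I\<close>.\<close>

lemma R_excess_eq:
  assumes \<rho>: "\<bar>\<rho>\<bar> \<le> 1" and c: "0 \<le> c"
  shows "R_excess \<rho> c = measure (bivariate_normal \<rho>) ({- c..c} \<times> {- c..c}) - (2 * std_normal_cdf c - 1)\<^sup>2"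
proof -
  define B where "B = bivariate_normal \<rho>"
  interpret B: prob_space B unfolding B_def by (rule bivariate_normal.prob_space_axioms)
  have sets_B[measurable_cong, simp]: "sets B = sets (borel \<Otimes>\<^sub>M borel)" by (simp add: B_def)
  define L where "L = {..<- c}"
  define I where "I = {- c..c}"
  define U where "U = {c<..}"
  have [measurable]: "L \<in> sets borel" "I \<in> sets borel" "U \<in> sets borel"
    by (auto simp: L_def I_def U_def)
  have disj: "L \<inter> I = {}" "L \<inter> U = {}" "I \<inter> U = {}" using c by (auto simp: L_def I_def U_def)
  have add_fst: "measure B ((S \<union> S') \<times> K) = measure B (S \<times> K) + measure B (S' \<times> K)"
    if "S \<inter> S' = {}" "S \<in> sets borel" "S' \<in> sets borel" "K \<in> sets borel" for S S' K
    using that by (subst B.finite_measure_Union[symmetric]) (auto intro!: arg_cong[where f="measure B"])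
  have add_snd: "measure B (K \<times> (S \<union> S')) = measure B (K \<times> S) + measure B (K \<times> S')"
    if "S \<inter> S' = {}" "S \<in> sets borel" "S' \<in> sets borel" "K \<in> sets borel" for S S' K
    using that by (subst B.finite_measure_Union[symmetric]) (auto intro!: arg_cong[where f="measure B"])
  have univ: "UNIV = L \<union> (I \<union> U)" "{..c} = L \<union> I" "{- c..} = I \<union> U"
    using c by (auto simp: L_def I_def U_def)
  have sym: "measure B (I \<times> U) = measure B (I \<times> L)" "measure B (U \<times> I) = measure B (L \<times> I)"
  proof -
    have "measure B (S \<times> K) = measure B (uminus ` S \<times> uminus ` K)"
      if [measurable]: "S \<in> sets borel" "K \<in> sets borel" for S K
    proof -
      have "measure B (S \<times> K) = measure (distr B (borel \<Otimes>\<^sub>M borel) (\<lambda>p. (- fst p, - snd p))) (S \<times> K)"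
        using bivariate_normal_uminus[OF \<rho>] by (simp add: B_def)
      also have "\<dots> = measure B ((\<lambda>p. (- fst p, - snd p)) -` (S \<times> K) \<inter> space B)"
        by (rule measure_distr) auto
      also have "(\<lambda>p. (- fst p, - snd p)) -` (S \<times> K) \<inter> space B = uminus ` S \<times> uminus ` K"
        by (force simp: B_def)
      finally show ?thesis .
    qed
    from this[of I U] this[of U I] show "measure B (I \<times> U) = measure B (I \<times> L)" "measure B (U \<times> I) = measure B (L \<times> I)"
      by (simp_all add: L_def I_def U_def)
  qed
  have fst: "measure B (S \<times> UNIV) = measure std_normal_distribution S" if [measurable]: "S \<in> sets borel" for S
    unfolding distr_fst_bivariate_normal[OF \<rho>, symmetric] B_def
    by (subst measure_distr) (auto intro!: arg_cong[where f="measure _"])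
  have snd: "measure B (UNIV \<times> S) = measure std_normal_distribution S" if [measurable]: "S \<in> sets borel" for S
    unfolding distr_snd_bivariate_normal[OF \<rho>, symmetric] B_def
    by (subst measure_distr) (auto intro!: arg_cong[where f="measure _"])
  define q where "q = std_normal_cdf c"
  \<comment> \<open>Rows \<open>L\<close> and \<open>I\<close> and column \<open>I\<close> of the
    grid. Given \<open>sym\<close>, these three equations determine the sum of the two quadrant
    probabilities from \<open>q\<close> and the central cell.\<close>
  have "measure B (L \<times> L) + (measure B (L \<times> I) + measure B (L \<times> U)) = 1 - q"
    using fst[of L] by (simp add: univ(1) add_snd disj Int_Un_distrib q_def) (simp add: L_def measure_std_normal_less_uminus)
  moreover have "measure B (I \<times> L) + (measure B (I \<times> I) + measure B (I \<times> U)) = 2 * q - 1"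
    using fst[of I] by (simp add: univ(1) add_snd disj Int_Un_distrib q_def) (simp add: I_def measure_std_normal_interval[OF c])
  moreover have "measure B (L \<times> I) + (measure B (I \<times> I) + measure B (U \<times> I)) = 2 * q - 1"
    using snd[of I] by (simp add: univ(1) add_fst disj Int_Un_distrib q_def) (simp add: I_def measure_std_normal_interval[OF c])
  moreover have "bivariate_normal_cdf \<rho> c c
      = measure B (L \<times> L) + measure B (L \<times> I) + measure B (I \<times> L) + measure B (I \<times> I)"
    by (simp add: bivariate_normal_cdf_def univ(2) B_def[symmetric] add_fst add_snd disj)
  moreover have "bivariate_normal_cdf (- \<rho>) c c
      = measure B (L \<times> I) + measure B (L \<times> U) + measure B (I \<times> I) + measure B (I \<times> U)"
  proof -
    have "bivariate_normal_cdf (- \<rho>) c c = measure B ((\<lambda>p. (fst p, - snd p)) -` ({..c} \<times> {..c}) \<inter> space B)"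
      unfolding bivariate_normal_cdf_def bivariate_normal_uminus_snd[OF \<rho>, symmetric]
      by (subst measure_distr) (auto simp: B_def)
    also have "(\<lambda>p. (fst p, - snd p)) -` ({..c} \<times> {..c}) \<inter> space B = {..c} \<times> {- c..}"
      by (auto simp: B_def)
    finally show ?thesis by (simp add: univ(2,3) add_fst add_snd disj)
  qed
  ultimately have "R_excess \<rho> c = measure B (I \<times> I) - (2 * q - 1)\<^sup>2"
    unfolding R_excess_def q_def[symmetric] sym by (simp add: power2_eq_square algebra_simps)
  then show ?thesis by (simp add: B_def I_def q_def)
qed

section \<open>Monotonicity in the correlation\<close>

text \<open>Stability of the normal law under independent sums. Writing the result as the law of
  \<open>s * x\<close> instead of by a density covers the degenerate case
  \<open>s = 0\<close>.\<close>

lemma distr_linear_std_normal_pair: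
  assumes "a\<^sup>2 + b\<^sup>2 = s\<^sup>2"
  shows "distr (std_normal_distribution \<Otimes>\<^sub>M std_normal_distribution) borel (\<lambda>p. a * fst p + b * snd p)
       = distr std_normal_distribution borel (\<lambda>x. s * x)"
proof (rule Levy_uniqueness)
  show "char (distr (std_normal_distribution \<Otimes>\<^sub>M std_normal_distribution) borel (\<lambda>p. a * fst p + b * snd p))
      = char (distr std_normal_distribution borel (\<lambda>x. s * x))"
  proof (rule ext)
    fix t
    have "char (distr (std_normal_distribution \<Otimes>\<^sub>M std_normal_distribution) borel (\<lambda>p. a * fst p + b * snd p)) t
        = (CLINT p|(std_normal_distribution \<Otimes>\<^sub>M std_normal_distribution). iexp ((t * a) * fst p + (t * b) * snd p))"
      unfolding char_def by (subst integral_distr) (auto simp: algebra_simps)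
    also have "\<dots> = complex_of_real (exp (- ((t * a)\<^sup>2 + (t * b)\<^sup>2) / 2))"
      by (rule char_linear_std_normal_pair)
    also have "(t * a)\<^sup>2 + (t * b)\<^sup>2 = (t * s)\<^sup>2"
      by (simp only: power_mult_distrib assms[symmetric] distrib_left)
    also have "complex_of_real (exp (- (t * s)\<^sup>2 / 2)) = (CLINT x|std_normal_distribution. iexp ((t * s) * x))"
      by (rule char_std_normal[symmetric])
    also have "\<dots> = char (distr std_normal_distribution borel (\<lambda>x. s * x)) t"
      unfolding char_def by (subst integral_distr) (auto simp: algebra_simps)
    finally show "char (distr (std_normal_distribution \<Otimes>\<^sub>M std_normal_distribution) borel (\<lambda>p. a * fst p + b * snd p)) t
        = char (distr std_normal_distribution borel (\<lambda>x. s * x)) t" .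
  qed
qed (auto intro!: std_normal_pair.real_distribution_distr std_normal.real_distribution_distr)

lemma integral_linear_std_normal_pair:
  fixes f :: "real \<Rightarrow> real"
  assumes [measurable]: "f \<in> borel_measurable borel" and bnd: "\<And>x. \<bar>f x\<bar> \<le> 1"
    and "a\<^sup>2 + b\<^sup>2 = s\<^sup>2"
  shows "(LINT x|std_normal_distribution. LINT y|std_normal_distribution. f (a * x + b * y))
       = (LINT x|std_normal_distribution. f (s * x))"
proof -
  have "(LINT x|std_normal_distribution. LINT y|std_normal_distribution. f (a * x + b * y))
      = (LINT p|(std_normal_distribution \<Otimes>\<^sub>M std_normal_distribution). f (a * fst p + b * snd p))"
    by (subst std_normal_pair.integral_fst'[symmetric])
       (auto intro!: std_normal_pair.integrable_const_bound[of _ 1] simp: bnd)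
  also have "\<dots> = (LINT x|distr (std_normal_distribution \<Otimes>\<^sub>M std_normal_distribution) borel (\<lambda>p. a * fst p + b * snd p). f x)"
    by (subst integral_distr) auto
  also have "\<dots> = (LINT x|std_normal_distribution. f (s * x))"
    unfolding distr_linear_std_normal_pair[OF assms(3)] by (subst integral_distr) auto
  finally show ?thesis .
qed

text \<open>Mehler's formula for the semigroup at time \<open>t\<close> with
  \<open>a = exp (- t)\<close>. In the parameter \<open>a\<close> the semigroup law becomes
  multiplication, and \<open>a = 0\<close>, the limit of infinite time, is included: there the
  operator takes the Gaussian mean.\<close>

definition ornstein_uhlenbeck :: "real \<Rightarrow> (real \<Rightarrow> real) \<Rightarrow> real \<Rightarrow> real" where
  "ornstein_uhlenbeck a f x = (LINT z|std_normal_distribution. f (a * x + sqrt (1 - a\<^sup>2) * z))"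

lemma borel_measurable_ornstein_uhlenbeck [measurable]:
  assumes [measurable]: "f \<in> borel_measurable borel"
  shows "ornstein_uhlenbeck a f \<in> borel_measurable borel"
  unfolding ornstein_uhlenbeck_def by measurable

lemma ornstein_uhlenbeck_bound:
  assumes "\<And>x. \<bar>f x\<bar> \<le> 1"
  shows "\<bar>ornstein_uhlenbeck a f x\<bar> \<le> 1"
proof -
  have "\<bar>ornstein_uhlenbeck a f x\<bar> \<le> (LINT z|std_normal_distribution. \<bar>f (a * x + sqrt (1 - a\<^sup>2) * z)\<bar>)"
    unfolding ornstein_uhlenbeck_def by (rule integral_abs_bound)
  also have "\<dots> \<le> (LINT z|std_normal_distribution. 1)"
    by (rule integral_mono_AE') (auto simp: assms)
  finally show ?thesis using std_normal.prob_space by simp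
qed

text \<open>The two independent noise terms have variances
  \<open>b\<^sup>2 * (1 - a\<^sup>2)\<close> and \<open>1 - b\<^sup>2\<close>, which add up to
  \<open>1 - (a * b)\<^sup>2\<close>; stability merges them into one.\<close>

lemma ornstein_uhlenbeck_mult:
  assumes "f \<in> borel_measurable borel" "\<And>x. \<bar>f x\<bar> \<le> 1" "0 \<le> a" "a \<le> 1" "0 \<le> b" "b \<le> 1"
  shows "ornstein_uhlenbeck a (ornstein_uhlenbeck b f) x = ornstein_uhlenbeck (a * b) f x"
proof -
  note [measurable] = assms(1)
  have le: "a\<^sup>2 \<le> 1" "b\<^sup>2 \<le> 1" "(a * b)\<^sup>2 \<le> 1"
    using assms by (simp_all add: power_le_one mult_le_one)
  have "ornstein_uhlenbeck a (ornstein_uhlenbeck b f) x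
     = (LINT y|std_normal_distribution. LINT z|std_normal_distribution.
          f (a * b * x + ((b * sqrt (1 - a\<^sup>2)) * y + sqrt (1 - b\<^sup>2) * z)))"
    unfolding ornstein_uhlenbeck_def by (simp add: algebra_simps)
  also have "\<dots> = (LINT z|std_normal_distribution. f (a * b * x + sqrt (1 - (a * b)\<^sup>2) * z))"
    by (rule integral_linear_std_normal_pair[where f="\<lambda>u. f (a * b * x + u)"])
       (use assms le in \<open>simp_all add: power_mult_distrib algebra_simps\<close>)
  finally show ?thesis by (simp add: ornstein_uhlenbeck_def)
qed

text \<open>Invariance of the Gaussian law, by stability with variances \<open>a\<^sup>2\<close> and
  \<open>1 - a\<^sup>2\<close>.\<close>

lemma integral_ornstein_uhlenbeck:
  assumes "f \<in> borel_measurable borel" "\<And>x. \<bar>f x\<bar> \<le> 1" "0 \<le> a" "a \<le> 1"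
  shows "(LINT x|std_normal_distribution. ornstein_uhlenbeck a f x) = (LINT x|std_normal_distribution. f x)"
proof -
  have "a\<^sup>2 \<le> 1" using assms by (simp add: power_le_one)
  then have "a\<^sup>2 + (sqrt (1 - a\<^sup>2))\<^sup>2 = 1\<^sup>2" by simp
  from integral_linear_std_normal_pair[OF assms(1,2) this] show ?thesis
    by (simp add: ornstein_uhlenbeck_def)
qed

text \<open>Jensen's inequality for the square, obtained from nonnegativity of a variance.
  Integrated against the invariant law it becomes contraction of the squared norm.\<close>

lemma ornstein_uhlenbeck_power2_le:
  assumes [measurable]: "f \<in> borel_measurable borel" and bnd: "\<And>x. \<bar>f x\<bar> \<le> 1"
  shows "(ornstein_uhlenbeck a f x)\<^sup>2 \<le> ornstein_uhlenbeck a (\<lambda>x. (f x)\<^sup>2) x"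
proof -
  let ?g = "\<lambda>z. f (a * x + sqrt (1 - a\<^sup>2) * z)"
  have "integrable std_normal_distribution ?g" "integrable std_normal_distribution (\<lambda>z. (?g z)\<^sup>2)"
    using bnd by (auto intro!: std_normal.integrable_const_bound[of _ 1] simp: abs_square_le_1)
  from std_normal.variance_eq[OF this] std_normal.variance_positive[of ?g] show ?thesis
    by (simp add: ornstein_uhlenbeck_def)
qed

text \<open>A nonnegative correlation can be produced by a shared component: given it, the two
  coordinates are independent and identically distributed, so the conditional expectation of the
  product is a square.\<close>

lemma integral_bivariate_normal_eq_ornstein_uhlenbeck:
  fixes f :: "real \<Rightarrow> real"
  assumes \<rho>: "0 \<le> \<rho>" "\<rho> \<le> 1" and [measurable]: "f \<in> borel_measurable borel" and bnd: "\<And>x. \<bar>f x\<bar> \<le> 1"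
  shows "(LINT p|bivariate_normal \<rho>. f (fst p) * f (snd p))
       = (LINT x|std_normal_distribution. (ornstein_uhlenbeck (sqrt \<rho>) f x)\<^sup>2)"
proof -
  let ?S = "std_normal_distribution"
  let ?P = "?S \<Otimes>\<^sub>M (?S \<Otimes>\<^sub>M ?S)"
  interpret P: pair_prob_space ?S "?S \<Otimes>\<^sub>M ?S" ..
  \<comment> \<open>The first coordinate of \<open>p\<close> is the shared component, with weight
    \<open>sqrt \<rho>\<close>; the other two are private noises of variance
    \<open>1 - \<rho>\<close>. The covariance of \<open>X\<close> and \<open>Y\<close> is therefore
    \<open>\<rho>\<close>.\<close>
  define X where "X = (\<lambda>p::real \<times> real \<times> real. sqrt \<rho> * fst p + sqrt (1 - \<rho>) * fst (snd p))"
  define Y where "Y = (\<lambda>p::real \<times> real \<times> real. sqrt \<rho> * fst p + sqrt (1 - \<rho>) * snd (snd p))"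
  have [measurable]: "X \<in> borel_measurable ?P" "Y \<in> borel_measurable ?P"
    unfolding X_def Y_def by measurable
  have law: "distr ?P (borel \<Otimes>\<^sub>M borel) (\<lambda>p. (X p, Y p)) = bivariate_normal \<rho>"
  proof (rule distr_eq_bivariate_normal)
    fix s t
    have "(CLINT p|?P. iexp (s * X p + t * Y p))
        = (CLINT p|?P. iexp (((s + t) * sqrt \<rho>) * fst p)
            * iexp ((s * sqrt (1 - \<rho>)) * fst (snd p) + (t * sqrt (1 - \<rho>)) * snd (snd p)))"
      by (intro Bochner_Integration.integral_cong) (auto simp: X_def Y_def exp_add[symmetric] algebra_simps)
    also have "\<dots> = (CLINT x|?S. iexp (((s + t) * sqrt \<rho>) * x))
        * (CLINT p|(?S \<Otimes>\<^sub>M ?S). iexp ((s * sqrt (1 - \<rho>)) * fst p + (t * sqrt (1 - \<rho>)) * snd p))"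
      by (rule integral_pair_mult)
         (auto simp: prob_space_std_normal std_normal_pair.prob_space_axioms simp del: of_real_mult of_real_add)
    also have "\<dots> = complex_of_real (exp (- (s\<^sup>2 + 2 * \<rho> * s * t + t\<^sup>2) / 2))"
    proof -
      have "((s + t) * sqrt \<rho>)\<^sup>2 + ((s * sqrt (1 - \<rho>))\<^sup>2 + (t * sqrt (1 - \<rho>))\<^sup>2) = s\<^sup>2 + 2 * \<rho> * s * t + t\<^sup>2"
        using \<rho> by (simp add: power_mult_distrib) (simp add: power2_eq_square algebra_simps)
      then show ?thesis
        unfolding char_std_normal char_linear_std_normal_pair of_real_mult[symmetric] exp_add[symmetric]
        by (simp add: field_simps)
    qed
    finally show "(CLINT p|?P. iexp (s * X p + t * Y p)) = complex_of_real (exp (- (s\<^sup>2 + 2 * \<rho> * s * t + t\<^sup>2) / 2))" .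
  qed (use \<rho> in \<open>auto simp: P.prob_space_axioms\<close>)
  have bnd2: "\<bar>f a * f b\<bar> \<le> 1" for a b
    using bnd[of a] bnd[of b] by (simp add: abs_mult mult_le_one)
  have "(LINT p|bivariate_normal \<rho>. f (fst p) * f (snd p)) = (LINT p|?P. f (X p) * f (Y p))"
    unfolding law[symmetric] by (subst integral_distr) auto
  also have "\<dots> = (LINT x|?S. LINT p|(?S \<Otimes>\<^sub>M ?S). f (X (x, p)) * f (Y (x, p)))"
    by (rule P.integral_fst'[symmetric]) (auto intro!: P.integrable_const_bound[of _ 1] simp: bnd2)
  also have "\<dots> = (LINT x|?S. (ornstein_uhlenbeck (sqrt \<rho>) f x)\<^sup>2)"
  proof (rule Bochner_Integration.integral_cong[OF refl])
    fix x
    let ?g = "\<lambda>z. f (sqrt \<rho> * x + sqrt (1 - \<rho>) * z)"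
    have "(LINT p|(?S \<Otimes>\<^sub>M ?S). ?g (fst p) * ?g (snd p)) = (LINT y|?S. LINT z|?S. ?g y * ?g z)"
      by (subst std_normal_pair.integral_fst'[symmetric])
         (auto intro!: std_normal_pair.integrable_const_bound[of _ 1] simp: bnd2)
    then show "(LINT p|(?S \<Otimes>\<^sub>M ?S). f (X (x, p)) * f (Y (x, p))) = (ornstein_uhlenbeck (sqrt \<rho>) f x)\<^sup>2"
      using \<rho> by (simp add: X_def Y_def ornstein_uhlenbeck_def power2_eq_square)
  qed
  finally show ?thesis .
qed

lemma integral_bivariate_normal_mono:
  fixes f :: "real \<Rightarrow> real"
  assumes \<rho>: "0 \<le> \<rho>" "\<rho> \<le> \<rho>'" "\<rho>' \<le> 1"
    and f[measurable]: "f \<in> borel_measurable borel" and bnd: "\<And>x. \<bar>f x\<bar> \<le> 1"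
  shows "(LINT p|bivariate_normal \<rho>. f (fst p) * f (snd p)) \<le> (LINT p|bivariate_normal \<rho>'. f (fst p) * f (snd p))"
proof (cases "\<rho>' = 0")
  case False
  define h where "h = ornstein_uhlenbeck (sqrt \<rho>') f"
  have h[measurable]: "h \<in> borel_measurable borel" unfolding h_def by measurable
  have hbnd: "\<bar>h x\<bar> \<le> 1" for x unfolding h_def by (rule ornstein_uhlenbeck_bound[OF bnd])
  have h2bnd: "\<bar>(h x)\<^sup>2\<bar> \<le> 1" for x using hbnd[of x] by (simp add: abs_square_le_1)
  \<comment> \<open>The smaller correlation is reached from the larger one by a further operator
    with parameter \<open>\<theta>\<close>, and this operator contracts. Dividing by
    \<open>\<rho>'\<close> is why \<open>\<rho>' = 0\<close>, where both correlations vanish, is a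
    separate case.\<close>
  define \<theta> where "\<theta> = sqrt (\<rho> / \<rho>')"
  have \<theta>: "0 \<le> \<theta>" "\<theta> \<le> 1" "\<theta> * sqrt \<rho>' = sqrt \<rho>"
    using \<rho> False by (auto simp: \<theta>_def real_sqrt_mult[symmetric] divide_le_eq_1)
  have "ornstein_uhlenbeck (sqrt \<rho>) f x = ornstein_uhlenbeck \<theta> h x" for x
    using \<theta> \<rho> unfolding h_def
    by (subst ornstein_uhlenbeck_mult[OF f bnd]) auto
  then have "(LINT x|std_normal_distribution. (ornstein_uhlenbeck (sqrt \<rho>) f x)\<^sup>2)
      \<le> (LINT x|std_normal_distribution. ornstein_uhlenbeck \<theta> (\<lambda>x. (h x)\<^sup>2) x)"
    using ornstein_uhlenbeck_bound[OF h2bnd, of \<theta>] ornstein_uhlenbeck_bound[OF hbnd, of \<theta>]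
    by (intro integral_mono)
       (auto intro!: std_normal.integrable_const_bound[of _ 1] ornstein_uhlenbeck_power2_le
             simp: hbnd abs_square_le_1)
  also have "\<dots> = (LINT x|std_normal_distribution. (h x)\<^sup>2)"
    by (rule integral_ornstein_uhlenbeck) (use h2bnd \<theta> in auto)
  finally show ?thesis
    using \<rho> by (simp add: integral_bivariate_normal_eq_ornstein_uhlenbeck[OF _ _ f bnd] h_def)
qed (use \<rho> in simp)

lemma measure_bivariate_normal_square:
  assumes [measurable]: "I \<in> sets borel"
  shows "measure (bivariate_normal \<rho>) (I \<times> I) = (LINT p|bivariate_normal \<rho>. indicator I (fst p) * indicator I (snd p))"
proof -
  have "(LINT p|bivariate_normal \<rho>. indicator I (fst p) * indicator I (snd p) :: real)
      = (LINT p|bivariate_normal \<rho>. indicator (I \<times> I) p)"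
    by (intro Bochner_Integration.integral_cong) (auto split: split_indicator)
  then show ?thesis by simp
qed

text \<open>The interval is symmetric, so reflecting one coordinate replaces \<open>\<rho>\<close>
  by its absolute value, where the monotonicity for nonnegative correlations applies.\<close>

lemma measure_bivariate_normal_square_mono:
  assumes \<rho>: "\<bar>\<rho>\<bar> \<le> \<rho>'" "\<rho>' \<le> 1"
  shows "measure (bivariate_normal \<rho>) ({- c..c} \<times> {- c..c}) \<le> measure (bivariate_normal \<rho>') ({- c..c} \<times> {- c..c})"
proof -
  have "measure (bivariate_normal (- \<rho>)) ({- c..c} \<times> {- c..c}) = measure (bivariate_normal \<rho>) ({- c..c} \<times> {- c..c})"
    unfolding bivariate_normal_uminus_snd[of \<rho>, symmetric, OF order_trans[OF \<rho>]]
    by (subst measure_distr) (auto intro!: arg_cong[where f="measure _"])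
  then have "measure (bivariate_normal \<rho>) ({- c..c} \<times> {- c..c}) = measure (bivariate_normal \<bar>\<rho>\<bar>) ({- c..c} \<times> {- c..c})"
    by (cases "0 \<le> \<rho>") auto
  also have "\<dots> \<le> measure (bivariate_normal \<rho>') ({- c..c} \<times> {- c..c})"
    unfolding measure_bivariate_normal_square[OF atLeastAtMost_borel]
    using \<rho> by (intro integral_bivariate_normal_mono) (auto split: split_indicator)
  finally show ?thesis .
qed

lemma R_excess_mono:
  assumes "\<bar>\<rho>\<bar> \<le> \<rho>'" "\<rho>' \<le> 1" "0 \<le> c"
  shows "R_excess \<rho> c \<le> R_excess \<rho>' c"
  using measure_bivariate_normal_square_mono[of \<rho> \<rho>' c] assms by (simp add: R_excess_eq)

text \<open>Correlation zero means independence, hence excess zero, and monotonicity does the rest.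
  Nonnegativity allows the excess to be added also for pairs with a large overlap.\<close>

lemma R_excess_nonneg:
  assumes "0 \<le> \<rho>" "\<rho> \<le> 1" "0 \<le> c"
  shows "0 \<le> R_excess \<rho> c"
proof -
  have "measure (bivariate_normal 0) ({- c..c} \<times> {- c..c}) = (measure std_normal_distribution {- c..c})\<^sup>2"
  proof -
    have "measure (bivariate_normal 0) ({- c..c} \<times> {- c..c})
        = measure (std_normal_distribution \<Otimes>\<^sub>M std_normal_distribution) ({- c..c} \<times> {- c..c})"
      unfolding bivariate_normal_def
      by (subst measure_distr) (auto simp: space_pair_measure intro!: arg_cong[where f="measure _"])
    also have "\<dots> = (measure std_normal_distribution {- c..c})\<^sup>2"
      by (simp add: measure_def std_normal.emeasure_pair_measure_Times enn2real_mult power2_eq_square)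
    finally show ?thesis .
  qed
  then have "R_excess 0 c = 0"
    using assms by (simp add: R_excess_eq measure_std_normal_interval)
  with R_excess_mono[of 0 \<rho> c] assms show ?thesis by simp
qed

section \<open>Overlap of uniform random subsets\<close>

lemma card_supersets:
  assumes "finite D" "S \<subseteq> D" "card S \<le> n"
  shows "card {B. B \<subseteq> D \<and> card B = n \<and> S \<subseteq> B} = (card D - card S) choose (n - card S)"
proof -
  have fin: "finite S" using assms finite_subset by auto
  have "bij_betw (\<lambda>B. B \<union> S) {B. B \<subseteq> D - S \<and> card B = n - card S} {B. B \<subseteq> D \<and> card B = n \<and> S \<subseteq> B}"
  proof (rule bij_betwI[where g="\<lambda>B. B - S"])
    show "(\<lambda>B. B \<union> S) \<in> {B. B \<subseteq> D - S \<and> card B = n - card S} \<rightarrow> {B. B \<subseteq> D \<and> card B = n \<and> S \<subseteq> B}"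
    proof
      fix B assume B: "B \<in> {B. B \<subseteq> D - S \<and> card B = n - card S}"
      then have "finite B" using assms(1) finite_subset[of B D] by auto
      with B have "card (B \<union> S) = card B + card S" using fin by (intro card_Un_disjoint) auto
      with B assms show "B \<union> S \<in> {B. B \<subseteq> D \<and> card B = n \<and> S \<subseteq> B}" by auto
    qed
    show "(\<lambda>B. B - S) \<in> {B. B \<subseteq> D \<and> card B = n \<and> S \<subseteq> B} \<rightarrow> {B. B \<subseteq> D - S \<and> card B = n - card S}"
      using fin by (auto simp: card_Diff_subset)
  qed auto
  then have "card {B. B \<subseteq> D \<and> card B = n \<and> S \<subseteq> B} = card {B. B \<subseteq> D - S \<and> card B = n - card S}"
    by (simp add: bij_betw_same_card)
  also have "\<dots> = card (D - S) choose (n - card S)"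
    using assms by (intro n_subsets) simp
  also have "card (D - S) = card D - card S" using assms fin by (simp add: card_Diff_subset)
  finally show ?thesis .
qed

text \<open>The quotient of the binomial coefficients is the probability that a random
  \<open>n\<close>-subset contains \<open>k\<close> given points, a product of factors
  \<open>(n - i) / (N - i)\<close>, each at most \<open>n / N\<close>. The induction peels off one
  factor by the absorption identity.\<close>

lemma binomial_diff_le:
  assumes "k \<le> n" "n \<le> N" "0 < N"
  shows "real ((N - k) choose (n - k)) \<le> (real n / real N) ^ k * real (N choose n)"
  using assms(1)
proof (induction k)
  case (Suc k)
  have eq: "real (n - k) * real ((N - k) choose (n - k)) = real (N - k) * real ((N - Suc k) choose (n - Suc k))"
  proof -
    have "(n - k) * ((N - k) choose (n - k)) = (N - k) * ((N - Suc k) choose (n - Suc k))"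
      using times_binomial_minus1_eq[of "n - k" "N - k"] Suc.prems by simp
    then show ?thesis by (metis of_nat_mult)
  qed
  have pos: "0 < real (N - k)" using Suc.prems assms by simp
  then have "real ((N - Suc k) choose (n - Suc k)) = real (n - k) / real (N - k) * real ((N - k) choose (n - k))"
    using eq by (simp add: field_simps)
  also have "\<dots> \<le> real n / real N * real ((N - k) choose (n - k))"
  proof (rule mult_right_mono)
    have "real k * real n \<le> real k * real N" using assms by (intro mult_left_mono) auto
    then show "real (n - k) / real (N - k) \<le> real n / real N"
      using pos assms Suc.prems by (simp add: field_simps of_nat_diff)
  qed simp
  also have "\<dots> \<le> real n / real N * ((real n / real N) ^ k * real (N choose n))"
    using Suc by (intro mult_left_mono) auto
  finally show ?case by simp
qed simp

text \<open>
  Expanding \<open>(1 + y) ^ card (A \<inter> B)\<close> over the subsets of \<open>A \<inter> B\<close> compares the moment generating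
  function of the hypergeometric law with that of the binomial law, term by term.
\<close>

lemma sum_power_card_inter_le:
  fixes y :: real
  assumes "finite D" "A \<subseteq> D" "n \<le> card D" "0 < card D" "0 \<le> y"
  shows "(\<Sum>B | B \<subseteq> D \<and> card B = n. (1 + y) ^ card (A \<inter> B))
     \<le> (1 + y * (real n / real (card D))) ^ card A * real (card D choose n)"
proof -
  let ?N = "card D"
  let ?F = "{B. B \<subseteq> D \<and> card B = n}"
  have fin: "finite A" "finite ?F" using assms finite_subset by auto
  have expand: "(1 + z) ^ card K = (\<Sum>S\<in>Pow K. z ^ card S)" if "finite K" for z :: real and K :: "'a set"
    using prod_add[OF that, of "\<lambda>_. z" "\<lambda>_. 1"] by (simp add: add.commute)
  have "(\<Sum>B\<in>?F. (1 + y) ^ card (A \<inter> B)) = (\<Sum>B\<in>?F. \<Sum>S\<in>Pow (A \<inter> B). y ^ card S)"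
    using fin by (intro sum.cong refl expand) auto
  \<comment> \<open>The inner range is made independent of \<open>B\<close> so that the two sums can
    be exchanged.\<close>
  also have "\<dots> = (\<Sum>B\<in>?F. \<Sum>S\<in>Pow A. if S \<subseteq> B then y ^ card S else 0)"
  proof (rule sum.cong[OF refl])
    fix B
    have "Pow (A \<inter> B) = {S. S \<in> Pow A \<and> S \<subseteq> B}" by auto
    then show "(\<Sum>S\<in>Pow (A \<inter> B). y ^ card S) = (\<Sum>S\<in>Pow A. if S \<subseteq> B then y ^ card S else 0)"
      using fin by (simp only: sum.inter_filter finite_Pow_iff)
  qed
  also have "\<dots> = (\<Sum>S\<in>Pow A. \<Sum>B\<in>?F. if S \<subseteq> B then y ^ card S else 0)"
    by (rule sum.swap)
  also have "\<dots> = (\<Sum>S\<in>Pow A. y ^ card S * real (card {B. B \<subseteq> D \<and> card B = n \<and> S \<subseteq> B}))"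
  proof (intro sum.cong refl)
    fix S
    have "?F \<inter> {B. S \<subseteq> B} = {B. B \<subseteq> D \<and> card B = n \<and> S \<subseteq> B}" by auto
    then show "(\<Sum>B\<in>?F. if S \<subseteq> B then y ^ card S else 0) = y ^ card S * real (card {B. B \<subseteq> D \<and> card B = n \<and> S \<subseteq> B})"
      using fin by (simp add: sum.If_cases)
  qed
  also have "\<dots> \<le> (\<Sum>S\<in>Pow A. y ^ card S * ((real n / real ?N) ^ card S * real (?N choose n)))"
  proof (intro sum_mono mult_left_mono)
    fix S assume "S \<in> Pow A"
    then have S: "S \<subseteq> D" using assms by auto
    show "real (card {B. B \<subseteq> D \<and> card B = n \<and> S \<subseteq> B}) \<le> (real n / real ?N) ^ card S * real (?N choose n)"
    proof (cases "card S \<le> n")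
      case True
      then show ?thesis
        using card_supersets[OF assms(1) S] binomial_diff_le[of "card S" n ?N] assms by simp
    next
      case False
      then have "{B. B \<subseteq> D \<and> card B = n \<and> S \<subseteq> B} = {}"
        using assms(1) by (auto dest: card_mono finite_subset)
      then show ?thesis by (simp only: card.empty) simp
    qed
  qed (use assms in simp)
  also have "\<dots> = (1 + y * (real n / real ?N)) ^ card A * real (?N choose n)"
    unfolding expand[OF fin(1)] sum_distrib_right by (intro sum.cong) (auto simp: power_mult_distrib mult_ac power_divide)
  finally show ?thesis .
qed

section \<open>Tail bounds for the overlap with a fixed set\<close>

text \<open>Markov's inequality applied to \<open>z\<close> raised to the overlap. The base
  \<open>z\<close> stays free because the two bounds in \<open>p_mixed\<close> come from different
  choices of it.\<close>

lemma card_inter_tail_markov: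
  fixes a z :: real
  assumes "finite D" "A \<subseteq> D" "n \<le> card D" "0 < card D" "1 \<le> z"
  shows "real (card {B. B \<subseteq> D \<and> card B = n \<and> a < real (card (A \<inter> B))}) / real (card D choose n)
     \<le> (1 + (z - 1) * (real n / real (card D))) ^ card A / z powr a"
proof -
  let ?T = "{B. B \<subseteq> D \<and> card B = n \<and> a < real (card (A \<inter> B))}"
  have "real (card ?T) * z powr a = (\<Sum>B\<in>?T. z powr a)" by simp
  also have "\<dots> \<le> (\<Sum>B\<in>?T. z ^ card (A \<inter> B))"
  proof (intro sum_mono)
    fix B assume "B \<in> ?T"
    then have "z powr a \<le> z powr real (card (A \<inter> B))" using assms by (intro powr_mono) auto
    then show "z powr a \<le> z ^ card (A \<inter> B)" using assms by (simp add: powr_realpow)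
  qed
  also have "\<dots> \<le> (\<Sum>B | B \<subseteq> D \<and> card B = n. z ^ card (A \<inter> B))"
    using assms by (intro sum_mono2) auto
  also have "\<dots> \<le> (1 + (z - 1) * (real n / real (card D))) ^ card A * real (card D choose n)"
    using sum_power_card_inter_le[OF assms(1-4), of "z - 1"] assms by simp
  finally show ?thesis
    using assms by (simp add: field_simps)
qed

lemma card_inter_tail_le_p_mixed:
  fixes r \<rho>\<^sub>0 :: real
  assumes "finite D" "A \<subseteq> D" "card A = n" "0 < card D" "real n = real (card D) * r" "0 < r" "r < \<rho>\<^sub>0"
  shows "real (card {B. B \<subseteq> D \<and> card B = n \<and> \<rho>\<^sub>0 * real n < real (card (A \<inter> B))}) / real (card D choose n)
     \<le> p_mixed (card D) r \<rho>\<^sub>0"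
proof -
  let ?N = "real (card D)"
  let ?P = "real (card {B. B \<subseteq> D \<and> card B = n \<and> \<rho>\<^sub>0 * real n < real (card (A \<inter> B))}) / real (card D choose n)"
  define \<delta> where "\<delta> = \<rho>\<^sub>0 / r - 1"
  have \<delta>: "0 < \<delta>" "\<rho>\<^sub>0 = (1 + \<delta>) * r" using assms by (auto simp: \<delta>_def field_simps)
  have n: "n \<le> card D" using assms(1-3) card_mono by auto
  have r: "real n / ?N = r" using assms(4,5) by (simp del: card_gt_0_iff)
  have markov: "?P \<le> (1 + (z - 1) * r) ^ n / z powr (\<rho>\<^sub>0 * real n)" if "1 \<le> z" for z
    using card_inter_tail_markov[OF assms(1,2) n assms(4) that, of "\<rho>\<^sub>0 * real n"] assms(3) r by simp
  \<comment> \<open>Multiplicative Chernoff bound with \<open>z = 1 + \<delta>\<close>. The mean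
    overlap is \<open>?N * r\<^sup>2\<close>, and the threshold
    \<open>\<rho>\<^sub>0 * real n\<close> is \<open>1 + \<delta>\<close> times this mean.\<close>
  have "?P \<le> (exp \<delta> / (1 + \<delta>) powr (1 + \<delta>)) powr (?N * r\<^sup>2)"
  proof -
    have "?P \<le> (1 + \<delta> * r) ^ n / (1 + \<delta>) powr (\<rho>\<^sub>0 * real n)"
      using markov[of "1 + \<delta>"] \<delta> by simp
    also have "\<dots> \<le> exp (\<delta> * r) ^ n / (1 + \<delta>) powr (\<rho>\<^sub>0 * real n)"
      using \<delta> assms exp_ge_add_one_self[of "\<delta> * r"] by (intro divide_right_mono power_mono) auto
    also have "exp (\<delta> * r) ^ n = exp \<delta> powr (?N * r\<^sup>2)"
      using assms(5) by (simp add: exp_of_nat_mult[symmetric] powr_def power2_eq_square mult_ac)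
    also have "(1 + \<delta>) powr (\<rho>\<^sub>0 * real n) = ((1 + \<delta>) powr (1 + \<delta>)) powr (?N * r\<^sup>2)"
      using assms(5) \<delta>(2) by (simp add: powr_powr power2_eq_square mult_ac)
    also have "exp \<delta> powr (?N * r\<^sup>2) / \<dots> = (exp \<delta> / (1 + \<delta>) powr (1 + \<delta>)) powr (?N * r\<^sup>2)"
      by (simp add: powr_divide)
    finally show ?thesis .
  qed
  moreover have "?P \<le> exp (- 2 * \<delta>\<^sup>2 * ?N * r ^ 3)"
  proof -
    \<comment> \<open>Hoeffding bound with \<open>z = exp t\<close>. This \<open>t\<close> minimises
      \<open>t\<^sup>2 / 8 - \<delta> * r * t\<close>, the exponent per element of \<open>A\<close>;
      the minimum is \<open>- 2 * \<delta>\<^sup>2 * r\<^sup>2\<close>.\<close>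
    define t where "t = 4 * \<delta> * r"
    have t: "0 \<le> t" using \<delta> assms by (simp add: t_def)
    have pos: "0 < 1 + (exp t - 1) * r" using t assms by (intro add_pos_nonneg mult_nonneg_nonneg) auto
    \<comment> \<open>Hoeffding's lemma for the logarithmic moment generating function of a
      Bernoulli variable with success probability \<open>r\<close>.\<close>
    have "ln (1 + (exp t - 1) * r) \<le> r * t + t\<^sup>2 / 8"
      using Hoeffdings_lemma_aux[OF t, of r] assms by (simp add: mult_ac)
    then have "1 + (exp t - 1) * r \<le> exp (r * t + t\<^sup>2 / 8)"
      using pos by (metis exp_le_cancel_iff exp_ln)
    then have "(1 + (exp t - 1) * r) ^ n \<le> exp (r * t + t\<^sup>2 / 8) ^ n"
      using pos by (intro power_mono) auto
    then have "?P \<le> exp (r * t + t\<^sup>2 / 8) ^ n / exp t powr (\<rho>\<^sub>0 * real n)"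
      using t by (intro order_trans[OF markov[of "exp t"]] divide_right_mono) auto
    also have "\<dots> = exp (real n * (r * t + t\<^sup>2 / 8) - t * (\<rho>\<^sub>0 * real n))"
      by (simp add: exp_of_nat_mult[symmetric] powr_def exp_diff mult_ac)
    also have "real n * (r * t + t\<^sup>2 / 8) - t * (\<rho>\<^sub>0 * real n) = - 2 * \<delta>\<^sup>2 * ?N * r ^ 3"
      unfolding assms(5) t_def \<delta>(2) by (simp add: power2_eq_square power3_eq_cube field_simps)
    finally show ?thesis .
  qed
  ultimately show ?thesis by (simp add: p_mixed_def Let_def \<delta>_def)
qed

section \<open>Overlap of two independent random subsets\<close>

text \<open>Freezing the first variable: the event is split by the finitely many values of
  \<open>X i\<close>, and independence factors each piece. The bound is asked only at attained
  values, since those are the ones known to have the prescribed size in the application; other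
  values contribute zero.\<close>

lemma (in prob_space) prob_indep_vars_pair_le:
  assumes indep: "indep_vars (\<lambda>_. count_space S) X I" and ij: "i \<in> I" "j \<in> I" "i \<noteq> j" and S: "finite S"
    and le: "\<And>a. a \<in> X i ` space M \<Longrightarrow> prob {\<omega>\<in>space M. Q a (X j \<omega>)} \<le> p"
  shows "{\<omega>\<in>space M. Q (X i \<omega>) (X j \<omega>)} \<in> events" and "prob {\<omega>\<in>space M. Q (X i \<omega>) (X j \<omega>)} \<le> p"
proof -
  have meas: "X k \<in> measurable M (count_space S)" if "k \<in> I" for k
    using indep that by (auto simp: indep_vars_def)
  have in_S: "X k \<omega> \<in> S" if "k \<in> I" "\<omega> \<in> space M" for k \<omega>
    using measurable_space[OF meas] that by auto
  define E where "E a = (X i -` {a} \<inter> space M) \<inter> (X j -` {b\<in>S. Q a b} \<inter> space M)" for a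
  have ev: "X k -` B \<inter> space M \<in> events" if "k \<in> I" "B \<subseteq> S" for k B
    using meas[OF that(1)] that(2) by (intro measurable_sets) auto
  have E: "E a \<in> events" if "a \<in> S" for a
    unfolding E_def using that ij by (intro sets.Int ev) auto
  have eq: "{\<omega>\<in>space M. Q (X i \<omega>) (X j \<omega>)} = (\<Union>a\<in>S. E a)"
    using in_S ij by (auto simp: E_def)
  show "{\<omega>\<in>space M. Q (X i \<omega>) (X j \<omega>)} \<in> events"
    unfolding eq using S E by auto
  have pE: "prob (E a) = prob (X i -` {a} \<inter> space M) * prob {\<omega>\<in>space M. Q a (X j \<omega>)}" if "a \<in> S" for a
  proof -
    have "prob (\<Inter>k\<in>{i, j}. X k -` (if k = i then {a} else {b\<in>S. Q a b}) \<inter> space M)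
        = (\<Prod>k\<in>{i, j}. prob (X k -` (if k = i then {a} else {b\<in>S. Q a b}) \<inter> space M))"
      using ij that by (intro indep_varsD[OF indep]) auto
    moreover have "X j -` {b\<in>S. Q a b} \<inter> space M = {\<omega>\<in>space M. Q a (X j \<omega>)}"
      using in_S ij by auto
    ultimately show ?thesis using ij by (simp add: E_def)
  qed
  have "prob {\<omega>\<in>space M. Q (X i \<omega>) (X j \<omega>)} = (\<Sum>a\<in>S. prob (E a))"
    unfolding eq using S E by (intro finite_measure_finite_Union) (auto simp: disjoint_family_on_def E_def)
  also have "\<dots> \<le> (\<Sum>a\<in>S. prob (X i -` {a} \<inter> space M) * p)"
  proof (rule sum_mono)
    fix a assume a: "a \<in> S"
    show "prob (E a) \<le> prob (X i -` {a} \<inter> space M) * p"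
    proof (cases "a \<in> X i ` space M")
      case True
      then show ?thesis using pE[OF a] le by (simp add: mult_left_mono)
    next
      case False
      then have "X i -` {a} \<inter> space M = {}" by auto
      then show ?thesis using pE[OF a] by simp
    qed
  qed
  also have "\<dots> = (\<Sum>a\<in>S. prob (X i -` {a} \<inter> space M)) * p" by (simp add: sum_distrib_right)
  also have "(\<Sum>a\<in>S. prob (X i -` {a} \<inter> space M)) = prob (\<Union>a\<in>S. X i -` {a} \<inter> space M)"
    using S ij by (intro finite_measure_finite_Union[symmetric]) (auto simp: disjoint_family_on_def intro!: ev)
  also have "(\<Union>a\<in>S. X i -` {a} \<inter> space M) = space M"
    using in_S ij by auto
  finally show "prob {\<omega>\<in>space M. Q (X i \<omega>) (X j \<omega>)} \<le> p" by (simp add: prob_space)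
qed

text \<open>With \<open>Ds i\<close> frozen at a realised set \<open>A\<close>, the overlap with the
  uniform set \<open>Ds j\<close> is hypergeometric, and the tail bound for a fixed set holds
  uniformly in \<open>A\<close>.\<close>

lemma egalitarian_overlap_prob_le:
  fixes \<rho>\<^sub>0 :: real
  assumes "prob_space M" and egal: "egalitarian M D C Ds r" and D: "finite D" "card D = N"
    and r: "0 < r N" "r N < \<rho>\<^sub>0" and ij: "i \<in> {1..C}" "j \<in> {1..C}" "i \<noteq> j"
  defines "J \<equiv> {\<omega>\<in>space M. \<rho>\<^sub>0 * (real N * r N) < real (card (Ds i \<omega> \<inter> Ds j \<omega>))}"
  shows "J \<in> sets M" and "measure M J \<le> p_mixed N (r N) \<rho>\<^sub>0"
proof -
  interpret prob_space M by fact
  have sub: "Ds i \<omega> \<subseteq> D" and frac: "real (card (Ds i \<omega>)) / real N = r N" if "\<omega> \<in> space M" for \<omega>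
    using egal ij that D by (auto simp: egalitarian_def)
  have indep: "indep_vars (\<lambda>_. count_space (Pow D)) Ds {1..C}"
    using egal by (simp add: egalitarian_def)
  have distr: "distr M (count_space (Pow D)) (Ds j)
      = uniform_measure (count_space (Pow D)) {A. A \<subseteq> D \<and> real (card A) = real N * r N}"
    using egal ij D by (auto simp: egalitarian_def)
  have meas: "Ds j \<in> measurable M (count_space (Pow D))"
    using indep ij by (auto simp: indep_vars_def)
  \<comment> \<open>Division by zero yields zero, so \<open>N = 0\<close> would force
    \<open>r N = 0\<close>.\<close>
  have N: "0 < N"
    using not_empty frac r by (metis all_not_in_conv div_by_0 gr0I of_nat_0 less_irrefl)
  have le: "prob {\<omega>\<in>space M. \<rho>\<^sub>0 * (real N * r N) < real (card (A \<inter> Ds j \<omega>))} \<le> p_mixed N (r N) \<rho>\<^sub>0"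
    if A: "A \<in> Ds i ` space M" for A
  proof -
    define n where "n = card A"
    have n: "real n = real N * r N" and AD: "A \<subseteq> D"
      using A frac sub N by (auto simp: n_def field_simps)
    let ?F = "{B. B \<subseteq> D \<and> card B = n}"
    let ?T = "{B. B \<subseteq> D \<and> \<rho>\<^sub>0 * real n < real (card (A \<inter> B))}"
    have F: "{B. B \<subseteq> D \<and> real (card B) = real N * r N} = ?F"
      unfolding n[symmetric] by auto
    have finF: "finite ?F" "finite ?T" using D by auto
    have "?F \<noteq> {}" using AD by (auto simp: n_def)
    have "emeasure (count_space (Pow D)) ?F = real (card ?F)"
      using finF by (subst emeasure_count_space_finite) (auto simp: ennreal_of_nat_eq_real_of_nat)
    then have F_pos: "emeasure (count_space (Pow D)) ?F \<noteq> 0" "emeasure (count_space (Pow D)) ?F \<noteq> \<infinity>"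
      using finF(1) \<open>?F \<noteq> {}\<close> by (simp_all add: card_eq_0_iff)
    have "{\<omega>\<in>space M. \<rho>\<^sub>0 * (real N * r N) < real (card (A \<inter> Ds j \<omega>))} = Ds j -` ?T \<inter> space M"
      using measurable_space[OF meas] n by auto
    then have "prob {\<omega>\<in>space M. \<rho>\<^sub>0 * (real N * r N) < real (card (A \<inter> Ds j \<omega>))}
        = measure (distr M (count_space (Pow D)) (Ds j)) ?T"
      using meas by (subst measure_distr) auto
    also have "\<dots> = measure (count_space (Pow D)) (?F \<inter> ?T) / measure (count_space (Pow D)) ?F"
      unfolding distr F by (rule measure_uniform_measure[OF F_pos]) auto
    also have "\<dots> = real (card (?F \<inter> ?T)) / real (card ?F)"
      using finF by (subst (1 2) measure_count_space) auto
    also have "?F \<inter> ?T = {B. B \<subseteq> D \<and> card B = n \<and> \<rho>\<^sub>0 * real n < real (card (A \<inter> B))}" by auto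
    also have "card ?F = N choose n" using n_subsets[OF D(1)] D(2) by simp
    finally show ?thesis
      using card_inter_tail_le_p_mixed[OF D(1) AD n_def[symmetric], of "r N" \<rho>\<^sub>0] D N n r by simp
  qed
  note * = prob_indep_vars_pair_le[where Q="\<lambda>A B. \<rho>\<^sub>0 * (real N * r N) < real (card (A \<inter> B))", OF indep ij _ le]
  show "J \<in> sets M" "measure M J \<le> p_mixed N (r N) \<rho>\<^sub>0"
    unfolding J_def using D by (intro *; simp)+
qed

section \<open>Rejections under joint normality\<close>

text \<open>The Cramer-Wold idea: each combination of the two statistics is normal or constant, so
  its first two moments fix its characteristic function at 1, and these values form the joint
  characteristic function of the pair.\<close>

lemma jointly_normal_pair_distr:
  assumes "prob_space M" and jn: "jointly_normal M I T" and I: "finite I" "i \<in> I" "j \<in> I" "i \<noteq> j"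
    and Di: "distributed M lborel (T i) std_normal_density" and Dj: "distributed M lborel (T j) std_normal_density"
    and \<rho>: "\<bar>correlation M (T i) (T j)\<bar> \<le> 1"
  shows "distr M (borel \<Otimes>\<^sub>M borel) (\<lambda>x. (T i x, T j x)) = bivariate_normal (correlation M (T i) (T j))"
proof (rule distr_eq_bivariate_normal)
  interpret prob_space M by fact
  show meas[measurable]: "T i \<in> borel_measurable M" "T j \<in> borel_measurable M"
    using jn I by (auto simp: jointly_normal_def)
  have sq: "expectation (\<lambda>x. (T k x)\<^sup>2) = 1 \<and> integrable M (\<lambda>x. (T k x)\<^sup>2) \<and> expectation (T k) = 0 \<and> integrable M (T k)"
    if D: "distributed M lborel (T k) std_normal_density" and [measurable]: "T k \<in> borel_measurable M" for k
  proof -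
    have e: "expectation (T k) = 0" using D by (rule standard_normal_distributed_expectation)
    then have v: "expectation (\<lambda>x. (T k x)\<^sup>2) = 1"
      using standard_normal_distributed_variance[OF D] by simp
    \<comment> \<open>The integral of a non-integrable function is 0 by convention, so the value 1
      certifies integrability.\<close>
    then have i: "integrable M (\<lambda>x. (T k x)\<^sup>2)"
      by (metis not_integrable_integral_eq zero_neq_one)
    with e v show ?thesis by (auto intro: square_integrable_imp_integrable)
  qed
  note mi = sq[OF Di meas(1)] and mj = sq[OF Dj meas(2)]
  have prod: "integrable M (\<lambda>x. T i x * T j x)"
  proof (rule Bochner_Integration.integrable_bound)
    show "integrable M (\<lambda>x. (T i x)\<^sup>2 + (T j x)\<^sup>2)" using mi mj by auto
    have "\<bar>a * b\<bar> \<le> a\<^sup>2 + b\<^sup>2" for a b :: real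
    proof -
      have "2 * (\<bar>a\<bar> * \<bar>b\<bar>) \<le> a\<^sup>2 + b\<^sup>2" using sum_squares_bound[of "\<bar>a\<bar>" "\<bar>b\<bar>"] by simp
      moreover have "0 \<le> \<bar>a\<bar> * \<bar>b\<bar>" by simp
      ultimately show ?thesis unfolding abs_mult by linarith
    qed
    then show "AE x in M. norm (T i x * T j x) \<le> norm ((T i x)\<^sup>2 + (T j x)\<^sup>2)" by auto
  qed auto
  have corr: "correlation M (T i) (T j) = expectation (\<lambda>x. T i x * T j x)"
    using mi mj by (simp add: correlation_def)
  fix s t
  define v where "v = s\<^sup>2 + 2 * correlation M (T i) (T j) * s * t + t\<^sup>2"
  define Z where "Z = (\<lambda>x. s * T i x + t * T j x)"
  have Z[measurable]: "Z \<in> borel_measurable M" unfolding Z_def by measurable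
  have Z_mean: "expectation Z = 0" unfolding Z_def using mi mj by simp
  have "expectation (\<lambda>x. (Z x)\<^sup>2) = expectation (\<lambda>x. s\<^sup>2 * (T i x)\<^sup>2 + 2 * s * t * (T i x * T j x) + t\<^sup>2 * (T j x)\<^sup>2)"
    by (intro Bochner_Integration.integral_cong) (auto simp: Z_def power2_eq_square algebra_simps)
  also have "\<dots> = v" using mi mj prod by (simp add: corr v_def)
  finally have Z_sq: "expectation (\<lambda>x. (Z x)\<^sup>2) = v" .
  \<comment> \<open>Joint normality speaks of combinations over all of \<open>I\<close>;
    coefficients vanishing off \<open>i\<close> and \<open>j\<close> pick out
    \<open>Z\<close>.\<close>
  have sum: "(\<Sum>k\<in>I. (if k = i then s else if k = j then t else 0) * T k x) = Z x" for x
  proof -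
    have "(\<Sum>k\<in>I. (if k = i then s else if k = j then t else 0) * T k x)
        = (\<Sum>k\<in>I. (if k = i then s * T k x else 0) + (if k = j then t * T k x else 0))"
      using I by (intro sum.cong) auto
    then show ?thesis using I by (simp add: sum.distrib Z_def)
  qed
  obtain \<mu> \<sigma> where "(0 < \<sigma> \<and> distributed M lborel Z (normal_density \<mu> \<sigma>)) \<or> (AE x in M. Z x = \<mu>)"
    using jn[unfolded jointly_normal_def, THEN conjunct2, rule_format, of "\<lambda>k. if k = i then s else if k = j then t else 0"]
    unfolding sum by auto
  then have "(CLINT x|M. iexp (Z x)) = complex_of_real (exp (- v / 2))"
  proof (elim disjE conjE)
    assume \<sigma>: "0 < \<sigma>" and D: "distributed M lborel Z (normal_density \<mu> \<sigma>)"
    have \<mu>: "\<mu> = 0" using normal_distributed_expectation[OF \<sigma> D] Z_mean by simp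
    have v: "v = \<sigma>\<^sup>2" using normal_distributed_variance[OF \<sigma> D] Z_mean Z_sq by simp
    have "distributed M lborel (\<lambda>x. (Z x - \<mu>) / \<sigma>) std_normal_density"
      using normal_standard_normal_convert[OF \<sigma>, of Z \<mu>] D by simp
    then have d: "distr M lborel (\<lambda>x. Z x / \<sigma>) = std_normal_distribution"
      unfolding distributed_def \<mu> by simp
    have "(CLINT x|M. iexp (Z x)) = (CLINT x|M. iexp (\<sigma> * (Z x / \<sigma>)))" using \<sigma> by simp
    also have "\<dots> = (CLINT x|std_normal_distribution. iexp (\<sigma> * x))"
      unfolding d[symmetric] by (subst integral_distr) auto
    also have "\<dots> = complex_of_real (exp (- v / 2))" unfolding v by (rule char_std_normal)
    finally show ?thesis .
  next
    \<comment> \<open>The degenerate case: a constant of mean zero, so \<open>v = 0\<close> and both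
      sides equal 1.\<close>
    assume c: "AE x in M. Z x = \<mu>"
    have "expectation Z = expectation (\<lambda>_. \<mu>)" using c by (intro integral_cong_AE) auto
    then have \<mu>: "\<mu> = 0" using Z_mean prob_space by simp
    have "expectation (\<lambda>x. (Z x)\<^sup>2) = expectation (\<lambda>_. 0)" using c \<mu> by (intro integral_cong_AE) auto
    then have v: "v = 0" using Z_sq by simp
    have "(CLINT x|M. iexp (Z x)) = (CLINT x|M. 1)" using c \<mu> by (intro integral_cong_AE) auto
    then show ?thesis using v prob_space by simp
  qed
  then show "(CLINT x|M. iexp (s * T i x + t * T j x))
      = complex_of_real (exp (- (s\<^sup>2 + 2 * correlation M (T i) (T j) * s * t + t\<^sup>2) / 2))"
    by (simp only: Z_def v_def)
qed (use assms in auto)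

lemma (in prob_space) prob_two_sided_rejection:
  assumes D: "distributed M lborel X std_normal_density" and c: "0 \<le> c"
  shows "prob {\<omega>\<in>space M. \<bar>X \<omega>\<bar> > c} = 2 * (1 - std_normal_cdf c)"
proof -
  have [measurable]: "X \<in> borel_measurable M" using distributed_measurable[OF D] by simp
  have "{\<omega>\<in>space M. \<bar>X \<omega>\<bar> > c} = space M - X -` {- c..c} \<inter> space M" by auto
  then have "prob {\<omega>\<in>space M. \<bar>X \<omega>\<bar> > c} = 1 - prob (X -` {- c..c} \<inter> space M)"
    by (simp add: prob_compl)
  also have "prob (X -` {- c..c} \<inter> space M) = measure (distr M lborel X) {- c..c}"
    by (subst measure_distr) auto
  also have "\<dots> = 2 * std_normal_cdf c - 1"
    using D measure_std_normal_interval[OF c] by (simp add: distributed_def)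
  finally show ?thesis by simp
qed

text \<open>Complementing both events leaves the covariance of their indicators unchanged, so the
  formula for the acceptance events carries over by inclusion-exclusion.\<close>

lemma (in prob_space) rejection_covariance_eq:
  assumes DX: "distributed M lborel X std_normal_density" and DY: "distributed M lborel Y std_normal_density"
    and law: "distr M (borel \<Otimes>\<^sub>M borel) (\<lambda>\<omega>. (X \<omega>, Y \<omega>)) = bivariate_normal \<rho>"
    and \<rho>: "\<bar>\<rho>\<bar> \<le> 1" and c: "0 \<le> c"
  shows "prob ({\<omega>\<in>space M. \<bar>X \<omega>\<bar> > c} \<inter> {\<omega>\<in>space M. \<bar>Y \<omega>\<bar> > c}) - (2 * (1 - std_normal_cdf c))\<^sup>2 = R_excess \<rho> c"
proof -
  have [measurable]: "X \<in> borel_measurable M" "Y \<in> borel_measurable M"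
    using distributed_measurable[OF DX] distributed_measurable[OF DY] by auto
  let ?A = "{\<omega>\<in>space M. \<bar>X \<omega>\<bar> > c}" and ?B = "{\<omega>\<in>space M. \<bar>Y \<omega>\<bar> > c}"
  have "measure (bivariate_normal \<rho>) ({- c..c} \<times> {- c..c}) = prob ((\<lambda>\<omega>. (X \<omega>, Y \<omega>)) -` ({- c..c} \<times> {- c..c}) \<inter> space M)"
    unfolding law[symmetric] by (subst measure_distr) auto
  also have "(\<lambda>\<omega>. (X \<omega>, Y \<omega>)) -` ({- c..c} \<times> {- c..c}) \<inter> space M = space M - (?A \<union> ?B)"
    by auto
  also have "prob \<dots> = 1 - prob (?A \<union> ?B)" by (intro prob_compl) auto
  also have "prob (?A \<union> ?B) = prob ?A + prob ?B - prob (?A \<inter> ?B)"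
    by (intro measure_Un3) (auto simp: fmeasurable_eq_sets)
  finally show ?thesis
    unfolding R_excess_eq[OF \<rho> c] prob_two_sided_rejection[OF DX c] prob_two_sided_rejection[OF DY c]
    by (simp add: power2_eq_square algebra_simps)
qed

section \<open>Summation over pairs of tests\<close>

lemma (in prob_space) variance_sum_indicators:
  fixes A :: "'i \<Rightarrow> 'a set"
  assumes I: "finite I" and A: "\<And>i. i \<in> I \<Longrightarrow> A i \<in> events" and p: "\<And>i. i \<in> I \<Longrightarrow> prob (A i) = p"
    and E: "\<And>\<omega>. \<omega> \<in> space M \<Longrightarrow> E \<omega> = (\<Sum>i\<in>I. indicator (A i) \<omega> :: real)"
  shows "variance E = (\<Sum>i\<in>I. \<Sum>j\<in>I. prob (A i \<inter> A j) - p\<^sup>2)"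
proof -
  have int: "integrable M (\<lambda>\<omega>. indicator B \<omega> :: real)" if "B \<in> events" for B
    using that by (simp add: emeasure_eq_measure)
  have "expectation E = expectation (\<lambda>\<omega>. \<Sum>i\<in>I. indicator (A i) \<omega>)"
    by (intro Bochner_Integration.integral_cong) (auto simp: E)
  also have "\<dots> = (\<Sum>i\<in>I. p)"
    using A p sets.sets_into_space by (subst Bochner_Integration.integral_sum) (auto simp: int Int_absorb2 intro!: sum.cong)
  finally have mean: "expectation E = (\<Sum>i\<in>I. p)" .
  have "variance E = expectation (\<lambda>\<omega>. \<Sum>i\<in>I. \<Sum>j\<in>I.
      (indicator (A i \<inter> A j) \<omega> - p * indicator (A i) \<omega> - p * indicator (A j) \<omega> + p\<^sup>2))"
  proof (rule Bochner_Integration.integral_cong[OF refl])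
    fix \<omega> assume "\<omega> \<in> space M"
    then have "(E \<omega> - expectation E)\<^sup>2 = (\<Sum>i\<in>I. indicator (A i) \<omega> - p)\<^sup>2"
      by (simp add: E mean sum_subtractf)
    also have "\<dots> = (\<Sum>i\<in>I. \<Sum>j\<in>I. (indicator (A i) \<omega> - p) * (indicator (A j) \<omega> - p))"
      by (simp add: power2_eq_square sum_product)
    finally show "(E \<omega> - expectation E)\<^sup>2 = (\<Sum>i\<in>I. \<Sum>j\<in>I.
        (indicator (A i \<inter> A j) \<omega> - p * indicator (A i) \<omega> - p * indicator (A j) \<omega> + p\<^sup>2))"
      by (simp add: indicator_inter_arith power2_eq_square algebra_simps)
  qed
  also have "\<dots> = (\<Sum>i\<in>I. \<Sum>j\<in>I. expectation (\<lambda>\<omega>. indicator (A i \<inter> A j) \<omega> - p * indicator (A i) \<omega> - p * indicator (A j) \<omega> + p\<^sup>2))"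
    using A by (subst Bochner_Integration.integral_sum)
      (auto intro!: sum.cong Bochner_Integration.integral_sum Bochner_Integration.integrable_sum
         Bochner_Integration.integrable_add Bochner_Integration.integrable_diff
         Bochner_Integration.integrable_mult_right int)
  also have "\<dots> = (\<Sum>i\<in>I. \<Sum>j\<in>I. prob (A i \<inter> A j) - p\<^sup>2)"
  proof (intro sum.cong refl)
    fix i j assume ij: "i \<in> I" "j \<in> I"
    have exp: "expectation (indicator B) = prob B" if "B \<in> events" for B
      using that sets.sets_into_space by (simp add: Int_absorb2)
    have "expectation (\<lambda>\<omega>. indicator (A i \<inter> A j) \<omega> - p * indicator (A i) \<omega> - p * indicator (A j) \<omega> + p\<^sup>2)
        = prob (A i \<inter> A j) - p * prob (A i) - p * prob (A j) + p\<^sup>2"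
      using A[OF ij(1)] A[OF ij(2)] by (simp add: int exp prob_space)
    then show "expectation (\<lambda>\<omega>. indicator (A i \<inter> A j) \<omega> - p * indicator (A i) \<omega> - p * indicator (A j) \<omega> + p\<^sup>2)
        = prob (A i \<inter> A j) - p\<^sup>2"
      using p ij by (simp add: power2_eq_square)
  qed
  finally show ?thesis .
qed

lemma sum_diagonal_offdiagonal:
  fixes a b :: real
  shows "(\<Sum>i=1..C. \<Sum>j=1..C. if i = j then a else b) = real C * a + real C * (real C - 1) * b"
proof -
  have "(\<Sum>j=1..C. if i = j then a else b) = a + (real C - 1) * b" if "i \<in> {1..C}" for i
  proof -
    have "(\<Sum>j=1..C. if i = j then a else b) = (\<Sum>j=1..C. b + (if i = j then a - b else 0))"
      by (intro sum.cong) auto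
    then show ?thesis using that by (simp add: sum.distrib algebra_simps)
  qed
  then have "(\<Sum>i=1..C. \<Sum>j=1..C. if i = j then a else b) = (\<Sum>i=1..C. a + (real C - 1) * b)"
    by (rule sum.cong[OF refl])
  then show ?thesis by (simp add: algebra_simps)
qed

theorem corollary4:
  fixes M :: "'a measure" and D :: "'d set" and N C :: nat
    and Ds :: "nat \<Rightarrow> 'a \<Rightarrow> 'd set" and T :: "nat \<Rightarrow> 'a \<Rightarrow> real"
    and r :: "nat \<Rightarrow> real" and \<alpha> c \<rho>\<^sub>0 :: real and E :: "'a \<Rightarrow> real"
  assumes "prob_space M"
    and "0 < \<alpha>" "\<alpha> < 1" and "2 \<le> C" and "std_normal_cdf c = 1 - \<alpha> / 2"
    and "finite D" and "card D = N"
    and "0 < r N" "r N < 1"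
    and "egalitarian M D C Ds r"
    and "r N < \<rho>\<^sub>0" "\<rho>\<^sub>0 \<le> 1"
    and "\<And>i. i \<in> {1..C} \<Longrightarrow> T i \<in> borel_measurable M"
    and "AE \<omega> in M. jointly_normal (given_draw M C Ds \<omega>) {1..C} T"
    and "AE \<omega> in M. \<forall>i\<in>{1..C}. distributed (given_draw M C Ds \<omega>) lborel (T i) std_normal_density"
    and "AE \<omega> in M. \<forall>i\<in>{1..C}. \<forall>j\<in>{1..C}. i \<noteq> j \<longrightarrow>
           \<bar>correlation (given_draw M C Ds \<omega>) (T i) (T j)\<bar>
             \<le> real (card (Ds i \<omega> \<inter> Ds j \<omega>)) / (real N * r N)"
    and "E = num_rejections C T c"
  shows "expected_cond_variance M C Ds E
           \<le> real C * \<alpha> * (1 - \<alpha>)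
             + real C * (real C - 1) * (\<alpha> * (1 - \<alpha>) * p_mixed N (r N) \<rho>\<^sub>0 + R_excess \<rho>\<^sub>0 c) \<and>
         EVR M C Ds E \<alpha>
           \<le> 1 + (real C - 1) / (\<alpha> * (1 - \<alpha>))
                 * (\<alpha> * (1 - \<alpha>) * p_mixed N (r N) \<rho>\<^sub>0 + R_excess \<rho>\<^sub>0 c)"
proof -
  interpret prob_space M by fact
  \<comment> \<open>Since \<alpha> is below 1, the distribution function at \<open>c\<close> exceeds
    one half.\<close>
  have c: "0 \<le> c"
    using std_normal_cdf_le_half[of c] assms(3,5) by (cases "c < 0") auto
  have \<alpha>_eq: "2 * (1 - std_normal_cdf c) = \<alpha>" using assms(5) by simp
  have \<rho>\<^sub>0: "0 \<le> \<rho>\<^sub>0" using assms by linarith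
  define \<beta> where "\<beta> = \<alpha> * (1 - \<alpha>)"
  have \<beta>: "0 < \<beta>" using assms by (simp add: \<beta>_def)
  have R: "0 \<le> R_excess \<rho>\<^sub>0 c" using \<rho>\<^sub>0 assms c by (intro R_excess_nonneg) auto
  define J where "J i j = {\<omega>\<in>space M. \<rho>\<^sub>0 * (real N * r N) < real (card (Ds i \<omega> \<inter> Ds j \<omega>))}" for i j
  have J: "J i j \<in> events" "prob (J i j) \<le> p_mixed N (r N) \<rho>\<^sub>0" if "i \<in> {1..C}" "j \<in> {1..C}" "i \<noteq> j" for i j
    unfolding J_def
    using egalitarian_overlap_prob_le[OF assms(1,10,6,7,8,11) that] by auto
  \<comment> \<open>A majorant of the conditional variance depending on the draw only through the
    events \<open>J i j\<close>. The diagonal carries the variance of one indicator; a pair is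
    charged the excess always and the maximal covariance \<open>\<beta>\<close> only when its
    overlap is large.\<close>
  define G where "G \<omega> = (\<Sum>i=1..C. \<Sum>j=1..C. if i = j then \<beta> else \<beta> * indicator (J i j) \<omega> + R_excess \<rho>\<^sub>0 c)" for \<omega>
  have G_nonneg: "0 \<le> G \<omega>" for \<omega>
    unfolding G_def using \<beta> R by (intro sum_nonneg) auto
  have int: "integrable M (\<lambda>\<omega>. if i = j then \<beta> else \<beta> * indicator (J i j) \<omega> + R_excess \<rho>\<^sub>0 c)"
    if "i \<in> {1..C}" "j \<in> {1..C}" for i j
    using J(1)[OF that] by (cases "i = j") (auto simp: emeasure_eq_measure)
  have G_int: "integrable M G"
    unfolding G_def by (intro Bochner_Integration.integrable_sum int)
  have N: "0 < real N * r N"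
  proof -
    obtain \<omega> where "\<omega> \<in> space M" using not_empty by auto
    moreover have "1 \<in> {1..C}" using assms(4) by simp
    ultimately have "real (card (Ds 1 \<omega>)) / real N = r N"
      using assms(7,10) by (auto simp: egalitarian_def)
    then have "N \<noteq> 0" using assms(8) by (cases "N = 0") auto
    then show ?thesis using assms(8) by simp
  qed
  have le: "AE \<omega> in M. cond_variance M C Ds E \<omega> \<le> G \<omega>"
    using assms(14-16) AE_space
  proof eventually_elim
    case (elim \<omega>)
    let ?M = "given_draw M C Ds \<omega>"
    have sp: "space ?M = space M" and st[measurable_cong]: "sets ?M = sets M"
      by (simp_all add: given_draw_def)
    have T: "T i \<in> borel_measurable ?M" if "i \<in> {1..C}" for i
      using assms(13)[OF that] by (simp add: measurable_cong_sets[OF st])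
    have dist: "distributed ?M lborel (T i) std_normal_density" if "i \<in> {1..C}" for i
      using elim that by auto
    have one: "1 \<in> {1..C}" using assms(4) by simp
    \<comment> \<open>That conditioning gives a probability measure is read off from the law of
      \<open>T 1\<close>, whose total mass is 1. This replaces a proof that almost every realised
      draw has positive probability.\<close>
    have "prob_space (distr ?M lborel (T 1))"
      using dist[OF one] prob_space_std_normal by (simp add: distributed_def)
    then interpret P: prob_space ?M
      using T[OF one] by (intro prob_space_distrD[of "T 1" _ lborel]) auto
    define A where "A i = {\<omega>'\<in>space ?M. \<bar>T i \<omega>'\<bar> > c}" for i
    have A: "A i \<in> P.events" if "i \<in> {1..C}" for i
      unfolding A_def using T[OF that] by measurable
    have pA: "P.prob (A i) = \<alpha>" if "i \<in> {1..C}" for i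
      unfolding A_def P.prob_two_sided_rejection[OF dist[OF that] c] by (rule \<alpha>_eq)
    have "cond_variance M C Ds E \<omega> = P.variance E" by (simp add: cond_variance_def)
    also have "\<dots> = (\<Sum>i=1..C. \<Sum>j=1..C. P.prob (A i \<inter> A j) - \<alpha>\<^sup>2)"
    proof (rule P.variance_sum_indicators)
      show "E \<omega>' = (\<Sum>i=1..C. indicator (A i) \<omega>')" if "\<omega>' \<in> space ?M" for \<omega>'
        unfolding assms(17) num_rejections_def A_def
        using that by (intro sum.cong refl) (auto split: split_indicator)
    qed (use A pA in auto)
    also have "\<dots> \<le> G \<omega>"
      unfolding G_def
    proof (intro sum_mono)
      fix i j assume ij: "i \<in> {1..C}" "j \<in> {1..C}"
      \<comment> \<open>The joint rejection probability is at most a single one, so each covariance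
        is at most \<open>\<alpha> - \<alpha>\<^sup>2\<close>, whatever the correlation.\<close>
      have "P.prob (A i \<inter> A j) \<le> \<alpha>"
        using P.finite_measure_mono[of "A i \<inter> A j" "A i"] A pA ij by auto
      then have le\<beta>: "P.prob (A i \<inter> A j) - \<alpha>\<^sup>2 \<le> \<beta>"
        by (simp add: \<beta>_def power2_eq_square algebra_simps)
      show "P.prob (A i \<inter> A j) - \<alpha>\<^sup>2 \<le> (if i = j then \<beta> else \<beta> * indicator (J i j) \<omega> + R_excess \<rho>\<^sub>0 c)"
      proof (cases "i = j \<or> \<omega> \<in> J i j")
        case True
        then show ?thesis using le\<beta> R by auto
      next
        case False
        let ?\<rho> = "correlation ?M (T i) (T j)"
        \<comment> \<open>Outside \<open>J i j\<close> the overlap fraction, and with it the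
          absolute correlation, is at most \<open>\<rho>\<^sub>0\<close>.\<close>
        have "real (card (Ds i \<omega> \<inter> Ds j \<omega>)) / (real N * r N) \<le> \<rho>\<^sub>0"
          using False elim N by (simp add: J_def divide_le_eq)
        moreover have "\<bar>?\<rho>\<bar> \<le> real (card (Ds i \<omega> \<inter> Ds j \<omega>)) / (real N * r N)"
          using elim ij False by blast
        ultimately have \<rho>: "\<bar>?\<rho>\<bar> \<le> \<rho>\<^sub>0" by linarith
        then have \<rho>1: "\<bar>?\<rho>\<bar> \<le> 1" using assms by linarith
        have "P.prob (A i \<inter> A j) - \<alpha>\<^sup>2 = R_excess ?\<rho> c"
          unfolding A_def \<alpha>_eq[symmetric]
          using elim ij False \<rho>1
          by (intro P.rejection_covariance_eq dist jointly_normal_pair_distr[where I="{1..C}"] P.prob_space_axioms c) auto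
        also have "\<dots> \<le> R_excess \<rho>\<^sub>0 c"
          using \<rho> assms(12) c by (rule R_excess_mono)
        finally show ?thesis using False by simp
      qed
    qed
    finally show ?case .
  qed
  \<comment> \<open>The comparison asks for integrability and nonnegativity of \<open>G\<close>
    alone: if the conditional variance were not integrable, its integral would be 0 by
    convention.\<close>
  have "expected_cond_variance M C Ds E \<le> expectation G"
    unfolding expected_cond_variance_def
    using G_int le by (rule integral_mono_AE') (simp add: G_nonneg)
  also have "expectation G = (\<Sum>i=1..C. \<Sum>j=1..C. if i = j then \<beta> else \<beta> * prob (J i j) + R_excess \<rho>\<^sub>0 c)"
  proof -
    have "expectation G = (\<Sum>i=1..C. \<Sum>j=1..C. expectation (\<lambda>\<omega>. if i = j then \<beta> else \<beta> * indicator (J i j) \<omega> + R_excess \<rho>\<^sub>0 c))"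
      unfolding G_def
      by (subst Bochner_Integration.integral_sum)
         (intro Bochner_Integration.integrable_sum int sum.cong[OF refl] Bochner_Integration.integral_sum; assumption)+
    also have "\<dots> = (\<Sum>i=1..C. \<Sum>j=1..C. if i = j then \<beta> else \<beta> * prob (J i j) + R_excess \<rho>\<^sub>0 c)"
    proof (intro sum.cong refl)
      fix i j assume ij: "i \<in> {1..C}" "j \<in> {1..C}"
      show "expectation (\<lambda>\<omega>. if i = j then \<beta> else \<beta> * indicator (J i j) \<omega> + R_excess \<rho>\<^sub>0 c)
          = (if i = j then \<beta> else \<beta> * prob (J i j) + R_excess \<rho>\<^sub>0 c)"
        using J(1)[OF ij] sets.sets_into_space[OF J(1)[OF ij]]
        by (cases "i = j") (auto simp: emeasure_eq_measure prob_space Int_absorb2)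
    qed
    finally show ?thesis .
  qed
  also have "\<dots> \<le> (\<Sum>i=1..C. \<Sum>j=1..C. if i = j then \<beta> else \<beta> * p_mixed N (r N) \<rho>\<^sub>0 + R_excess \<rho>\<^sub>0 c)"
    using J(2) \<beta> by (intro sum_mono) auto
  also have "\<dots> = real C * \<beta> + real C * (real C - 1) * (\<beta> * p_mixed N (r N) \<rho>\<^sub>0 + R_excess \<rho>\<^sub>0 c)"
    by (rule sum_diagonal_offdiagonal)
  finally have main: "expected_cond_variance M C Ds E
      \<le> real C * \<beta> + real C * (real C - 1) * (\<beta> * p_mixed N (r N) \<rho>\<^sub>0 + R_excess \<rho>\<^sub>0 c)" .
  have C: "0 < real C * \<beta>" using \<beta> assms(4) by simp
  have "EVR M C Ds E \<alpha> = expected_cond_variance M C Ds E / (real C * \<beta>)"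
    by (simp add: EVR_def \<beta>_def mult.assoc)
  also have "\<dots> \<le> (real C * \<beta> + real C * (real C - 1) * (\<beta> * p_mixed N (r N) \<rho>\<^sub>0 + R_excess \<rho>\<^sub>0 c)) / (real C * \<beta>)"
    using main C by (intro divide_right_mono) auto
  also have "\<dots> = 1 + (real C - 1) / \<beta> * (\<beta> * p_mixed N (r N) \<rho>\<^sub>0 + R_excess \<rho>\<^sub>0 c)"
    using \<beta> assms(4) by (simp add: add_divide_distrib)
  finally show ?thesis using main by (simp add: \<beta>_def mult.assoc)
qed

end
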